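(* Let $T \in \mathcal{AM}(H)$ be quasinormal. Then there exist reducing subspaces $H_1, H_\infty, H_2$ of $T$ with $\dim(H_1) < \infty$ such that $H = H_1 \oplus H_\infty \oplus H_2$ and $$T = \bigoplus_{i=1}^{n} \alpha_i U_i \ \oplus\ \alpha V_\infty \ \oplus\ \bigoplus_{j=1}^{m} \beta_j V_j$$ for some $n \in \mathbb{N}$ and $m \in \mathbb{N} \cup \{\infty\}$, where (i) $\sigma_{ess}(|T|) = \{\alpha\}$, $\alpha \geq 0$, $H_\infty = N(|T| - \alpha I)$ and $V_\infty \in \mathcal{B}(H_\infty)$ is an isometry; (ii) $\{\alpha_i\}_{i=1}^{n} = (\alpha, \|T\|] \cap \sigma(|T|)$, $H_1 = \bigoplus_{i=1}^{n} N(|T| - \alpha_i I)$ and $U_i \in \mathcal{B}(N(|T| - \alpha_i I))$ is a unitary operator for every $i$; (iii) $\{\beta_j\}_{j=1}^{m} = [m(T), \alpha) \cap \sigma(|T|)$, $H_2 = \bigoplus_{j=1}^{m} N(|T| - \beta_j I)$ and $V_j \in \mathcal{B}(N(|T| - \beta_j I))$ is a unitary operator for every $j$.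
   Context: $H$ is an infinite-dimensional complex Hilbert space and $\mathcal{B}(H)$ the bounded linear operators on $H$. $N(\cdot)$ denotes the null space, $\sigma(\cdot)$ the spectrum, $|T| = (T^*T)^{1/2}$. The minimum modulus of a bounded operator $S$ defined on a nonzero Hilbert space is $m(S) = \inf\{\|Sx\| : \|x\| = 1\}$; $S$ is minimum attaining if $\|Sx\| = m(S)$ for some unit vector $x$. $T \in \mathcal{AM}(H)$ (absolutely minimum attaining) means $T|_M : M \to H$ is minimum attaining for every nonzero closed subspace $M$ of $H$. $T$ is quasinormal if $T$ commutes with $T^*T$. $T$ is Fredholm if $R(T)$ is closed and $N(T)$, $N(T^* )$ are finite dimensional; $\sigma_{ess}(T) = \{\lambda \in \mathbb{C} : T - \lambda I \text{ is not Fredholm}\}$. The $\alpha_i$ are distinct, the $\beta_j$ are distinct. Either of the families $\{\alpha_i\}$, $\{\beta_j\}$ may be empty (i.e. $n=0$ or $m=0$), in which case the corresponding summand is absent and the corresponding subspace is $\{0\}$; $H_\infty$ may also be $\{0\}$. *)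

theory Defs
  imports "HOL-Analysis.Analysis" "HOL-Library.Extended_Nat"
begin

class scaleC = scaleR +
  fixes scaleC :: "complex \<Rightarrow> 'a \<Rightarrow> 'a"  (infixr "*\<^sub>C" 75)
  assumes scaleR_scaleC: "r *\<^sub>R x = complex_of_real r *\<^sub>C x"

class complex_vector = scaleC + ab_group_add +
  assumes scaleC_add_right: "a *\<^sub>C (x + y) = a *\<^sub>C x + a *\<^sub>C y"
    and scaleC_add_left: "(a + b) *\<^sub>C x = a *\<^sub>C x + b *\<^sub>C x"
    and scaleC_scaleC: "a *\<^sub>C (b *\<^sub>C x) = (a * b) *\<^sub>C x"
    and scaleC_one: "1 *\<^sub>C x = x"

interpretation complex_vector: vector_space "scaleC :: complex \<Rightarrow> 'a \<Rightarrow> 'a::complex_vector"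
  by unfold_locales
    (fact scaleC_add_right scaleC_add_left scaleC_scaleC scaleC_one)+

text \<open>The complex inner product is linear in its first argument. The real inner product of the
  library is its real part, so \<open>norm x\<close> is the usual norm and \<open>cinner x x\<close> is nonnegative and
  vanishes only at \<open>0\<close>.\<close>

class complex_inner = complex_vector + real_inner +
  fixes cinner :: "'a \<Rightarrow> 'a \<Rightarrow> complex"
  assumes cinner_commute: "cinner x y = cnj (cinner y x)"
    and cinner_add_left: "cinner (x + y) z = cinner x z + cinner y z"
    and cinner_scaleC_left: "cinner (c *\<^sub>C x) y = c * cinner x y"
    and inner_eq_Re_cinner: "inner x y = Re (cinner x y)"

class chilbert_space = complex_inner + complete_space

definition closed_csubspace :: "'a::complex_inner set \<Rightarrow> bool" where
  "closed_csubspace M \<longleftrightarrow> complex_vector.subspace M \<and> closed M"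

definition cfinite_dim :: "'a::complex_vector set \<Rightarrow> bool" where
  "cfinite_dim M \<longleftrightarrow> (\<exists>B. finite B \<and> M \<subseteq> complex_vector.span B)"

definition orth_complement :: "'a::complex_inner set \<Rightarrow> 'a set" where
  "orth_complement M = {x. \<forall>y\<in>M. cinner x y = 0}"

text \<open>\<open>bounded_ops M\<close> is the algebra of bounded operators on the subspace \<open>M\<close>. Such an operator is a
  function on the whole type of which only the values on \<open>M\<close> matter; operators on the
  full space are the elements of \<open>bounded_ops UNIV\<close>.\<close>

definition bounded_ops :: "'a::complex_inner set \<Rightarrow> ('a \<Rightarrow> 'a) set" where
  "bounded_ops M = {A. (\<forall>x\<in>M. A x \<in> M)
     \<and> (\<forall>x\<in>M. \<forall>y\<in>M. A (x + y) = A x + A y)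
     \<and> (\<forall>c. \<forall>x\<in>M. A (c *\<^sub>C x) = c *\<^sub>C A x)
     \<and> (\<exists>K. \<forall>x\<in>M. norm (A x) \<le> K * norm x)}"

lemma bounded_ops_UNIV_iff:
  "A \<in> bounded_ops UNIV \<longleftrightarrow> bounded_linear A \<and> (\<forall>c x. A (c *\<^sub>C x) = c *\<^sub>C A x)"
proof
  assume A: "A \<in> bounded_ops UNIV"
  then obtain K where "\<And>x. norm (A x) \<le> norm x * K"
    by (auto simp: bounded_ops_def mult.commute)
  then show "bounded_linear A \<and> (\<forall>c x. A (c *\<^sub>C x) = c *\<^sub>C A x)"
    using A by (auto intro!: bounded_linear_intro simp: bounded_ops_def scaleR_scaleC)
next
  assume A: "bounded_linear A \<and> (\<forall>c x. A (c *\<^sub>C x) = c *\<^sub>C A x)"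
  then interpret bounded_linear A by simp
  show "A \<in> bounded_ops UNIV"
    using A bounded by (auto simp: bounded_ops_def add mult.commute)
qed

definition is_adjoint :: "'a::complex_inner set \<Rightarrow> ('a \<Rightarrow> 'a) \<Rightarrow> ('a \<Rightarrow> 'a) \<Rightarrow> bool" where
  "is_adjoint M A B \<longleftrightarrow> B \<in> bounded_ops M \<and> (\<forall>x\<in>M. \<forall>y\<in>M. cinner (A x) y = cinner x (B y))"

text \<open>For bounded operators the descriptions in \<open>cadjoint\<close> and \<open>abs_op\<close> below have exactly one solution,
  by the Riesz representation theorem and by the existence and uniqueness of positive square
  roots.\<close>

definition cadjoint :: "('a::chilbert_space \<Rightarrow> 'a) \<Rightarrow> 'a \<Rightarrow> 'a" where
  "cadjoint A = (THE B. is_adjoint UNIV A B)"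

definition positive_op :: "('a::complex_inner \<Rightarrow> 'a) \<Rightarrow> bool" where
  "positive_op A \<longleftrightarrow> A \<in> bounded_ops UNIV
     \<and> (\<forall>x. Im (cinner (A x) x) = 0 \<and> 0 \<le> Re (cinner (A x) x))"

definition abs_op :: "('a::chilbert_space \<Rightarrow> 'a) \<Rightarrow> 'a \<Rightarrow> 'a" where
  "abs_op T = (THE P. positive_op P \<and> P \<circ> P = cadjoint T \<circ> T)"

definition isometry_on :: "'a::complex_inner set \<Rightarrow> ('a \<Rightarrow> 'a) \<Rightarrow> bool" where
  "isometry_on M V \<longleftrightarrow> V \<in> bounded_ops M \<and> (\<forall>x\<in>M. norm (V x) = norm x)"

definition unitary_on :: "'a::complex_inner set \<Rightarrow> ('a \<Rightarrow> 'a) \<Rightarrow> bool" where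
  "unitary_on M U \<longleftrightarrow> U \<in> bounded_ops M
     \<and> (\<exists>W. is_adjoint M U W \<and> (\<forall>x\<in>M. W (U x) = x \<and> U (W x) = x))"

definition quasinormal :: "('a::chilbert_space \<Rightarrow> 'a) \<Rightarrow> bool" where
  "quasinormal T \<longleftrightarrow> T \<in> bounded_ops UNIV
     \<and> T \<circ> (cadjoint T \<circ> T) = (cadjoint T \<circ> T) \<circ> T"

definition reducing :: "('a::complex_inner \<Rightarrow> 'a) \<Rightarrow> 'a set \<Rightarrow> bool" where
  "reducing T M \<longleftrightarrow> closed_csubspace M \<and> T ` M \<subseteq> M
     \<and> T ` orth_complement M \<subseteq> orth_complement M"

text \<open>\<open>min_modulus M T\<close> is the minimum modulus of the restriction of \<open>T\<close> to \<open>M\<close>, viewed as an operator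
  into the whole space; it is meaningful for \<open>M \<noteq> {0}\<close>.\<close>

definition min_modulus :: "'a::complex_inner set \<Rightarrow> ('a \<Rightarrow> 'a) \<Rightarrow> real" where
  "min_modulus M T = Inf {norm (T x) | x. x \<in> M \<and> norm x = 1}"

definition min_attaining :: "'a::complex_inner set \<Rightarrow> ('a \<Rightarrow> 'a) \<Rightarrow> bool" where
  "min_attaining M T \<longleftrightarrow> (\<exists>x\<in>M. norm x = 1 \<and> norm (T x) = min_modulus M T)"

definition abs_min_attaining :: "('a::chilbert_space \<Rightarrow> 'a) \<Rightarrow> bool" where
  "abs_min_attaining T \<longleftrightarrow> T \<in> bounded_ops UNIV
     \<and> (\<forall>M. closed_csubspace M \<and> M \<noteq> {0} \<longrightarrow> min_attaining M T)"

definition null_space :: "('a::zero \<Rightarrow> 'a) \<Rightarrow> 'a set" where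
  "null_space A = {x. A x = 0}"

definition minus_scalar :: "('a::complex_vector \<Rightarrow> 'a) \<Rightarrow> complex \<Rightarrow> 'a \<Rightarrow> 'a" where
  "minus_scalar A c = (\<lambda>x. A x - c *\<^sub>C x)"

definition spectrum :: "('a::complex_inner \<Rightarrow> 'a) \<Rightarrow> complex set" where
  "spectrum A = {c. \<not> (\<exists>B\<in>bounded_ops UNIV.
     B \<circ> minus_scalar A c = id \<and> minus_scalar A c \<circ> B = id)}"

definition fredholm :: "('a::chilbert_space \<Rightarrow> 'a) \<Rightarrow> bool" where
  "fredholm A \<longleftrightarrow> closed (range A) \<and> cfinite_dim (null_space A)
     \<and> cfinite_dim (null_space (cadjoint A))"

definition ess_spectrum :: "('a::chilbert_space \<Rightarrow> 'a) \<Rightarrow> complex set" where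
  "ess_spectrum A = {c. \<not> fredholm (minus_scalar A c)}"

text \<open>\<open>is_orth_sum K I M\<close>: the space \<open>K\<close> is the internal Hilbert direct sum of the pairwise
  orthogonal closed subspaces \<open>M i\<close>. Over the empty index set the sum is \<open>{0}\<close>.\<close>

definition is_orth_sum :: "'a::complex_inner set \<Rightarrow> 'i set \<Rightarrow> ('i \<Rightarrow> 'a set) \<Rightarrow> bool" where
  "is_orth_sum K I M \<longleftrightarrow> (\<forall>i\<in>I. closed_csubspace (M i))
     \<and> (\<forall>i\<in>I. \<forall>j\<in>I. i \<noteq> j \<longrightarrow> (\<forall>x\<in>M i. \<forall>y\<in>M j. cinner x y = 0))
     \<and> K = {y. \<exists>x. (\<forall>i\<in>I. x i \<in> M i) \<and> (x has_sum y) I}"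

text \<open>\<open>is_op_sum K I M A T\<close>: with respect to the decomposition of \<open>K\<close> into the \<open>M i\<close>, the operator \<open>T\<close>
  is the direct sum of the operators \<open>A i\<close> on \<open>M i\<close>.\<close>

definition is_op_sum ::
  "'a::complex_inner set \<Rightarrow> 'i set \<Rightarrow> ('i \<Rightarrow> 'a set) \<Rightarrow> ('i \<Rightarrow> 'a \<Rightarrow> 'a) \<Rightarrow> ('a \<Rightarrow> 'a) \<Rightarrow> bool" where
  "is_op_sum K I M A T \<longleftrightarrow> is_orth_sum K I M \<and> (\<forall>i\<in>I. A i \<in> bounded_ops (M i))
     \<and> (\<forall>x y. (\<forall>i\<in>I. x i \<in> M i) \<and> (x has_sum y) I \<longrightarrow> ((\<lambda>i. A i (x i)) has_sum T y) I)"

end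

theory Submission
  imports Defs
begin

text \<open>A minimiser of \<open>norm (T x)\<close> over the unit vectors orthogonal to a set of eigenvectors of \<open>T\<^sup>* T\<close>
  is again an eigenvector of \<open>T\<^sup>* T\<close>, so by Zorn's lemma there is an orthonormal basis \<open>G\<close> of
  eigenvectors, in which \<open>|T|\<close> is diagonal with entries \<open>norm (T g)\<close>. No orthonormal sequence with
  orthogonal images can have strictly decreasing \<open>norm (T (f k))\<close>, because \<open>T\<close> would not attain its
  minimum on the closed span. Mixing two basis vectors shows that the entries cannot be infinitely
  often below \<open>a\<close> and infinitely often above \<open>b > a\<close>; hence there is a single value \<open>\<alpha>\<close> such that
  only finitely many basis vectors have entries above \<open>\<alpha>\<close>, and only finitely many have entries at
  most \<open>b\<close> for each \<open>b < \<alpha>\<close>. This gives the spectrum and the essential spectrum of \<open>|T|\<close>. If \<open>T\<close> is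
  quasinormal, its matrix entries between eigenvectors for different eigenvalues vanish, so the
  eigenspaces of \<open>|T|\<close> reduce \<open>T\<close>, and \<open>T\<close> is \<open>c\<close> times an isometry on the eigenspace for \<open>c\<close>, which
  is unitary when the eigenspace is finite-dimensional.\<close>

section \<open>Complex inner products and orthonormal families\<close>

lemmas scaleC_zero_left [simp] = complex_vector.scale_zero_left
  and scaleC_zero_right [simp] = complex_vector.scale_zero_right

lemma scaleC_of_real: "complex_of_real r *\<^sub>C x = r *\<^sub>R x"
  by (simp add: scaleR_scaleC)

lemma cinner_add_right: "cinner x (y + z) = cinner x y + cinner x z"
  by (metis cinner_add_left cinner_commute complex_cnj_add)

lemma cinner_scaleC_right [simp]: "cinner x (c *\<^sub>C y) = cnj c * cinner x y"
  by (metis cinner_scaleC_left cinner_commute complex_cnj_mult)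

declare cinner_scaleC_left [simp]

lemma cinner_zero_left [simp]: "cinner 0 x = 0"
  using cinner_add_left[of 0 0 x] by simp

lemma cinner_zero_right [simp]: "cinner x 0 = 0"
  using cinner_add_right[of x 0 0] by simp

lemma cinner_minus_left [simp]: "cinner (- x) y = - cinner x y"
  using cinner_add_left[of x "- x" y] by (simp add: add_eq_0_iff)

lemma cinner_minus_right [simp]: "cinner x (- y) = - cinner x y"
  using cinner_add_right[of x y "- y"] by (simp add: add_eq_0_iff)

lemma cinner_diff_left: "cinner (x - y) z = cinner x z - cinner y z"
  using cinner_add_left[of x "- y" z] by simp

lemma cinner_diff_right: "cinner x (y - z) = cinner x y - cinner x z"
  using cinner_add_right[of x y "- z"] by simp

lemma cinner_sum_left: "cinner (sum f F) y = (\<Sum>i\<in>F. cinner (f i) y)"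
  by (induction F rule: infinite_finite_induct) (auto simp: cinner_add_left)

lemma cinner_sum_right: "cinner y (sum f F) = (\<Sum>i\<in>F. cinner y (f i))"
  by (induction F rule: infinite_finite_induct) (auto simp: cinner_add_right)

lemma cinner_scaleR_left [simp]: "cinner (r *\<^sub>R x) y = complex_of_real r * cinner x y"
  by (simp add: scaleR_scaleC)

lemma cinner_scaleR_right [simp]: "cinner x (r *\<^sub>R y) = complex_of_real r * cinner x y"
  by (simp add: scaleR_scaleC)

lemma cinner_eq_0_commute: "cinner x y = 0 \<longleftrightarrow> cinner y x = 0"
  by (metis cinner_commute complex_cnj_zero_iff)

lemma cinner_self: "cinner x x = complex_of_real ((norm x)\<^sup>2)"
proof -
  have "Im (cinner x x) = 0"
    using arg_cong[OF cinner_commute[of x x], of Im] by simp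
  then show ?thesis
    by (simp add: complex_eq_iff power2_norm_eq_inner inner_eq_Re_cinner)
qed

lemma cinner_self_eq_0 [simp]: "cinner x x = 0 \<longleftrightarrow> x = 0"
  by (simp add: cinner_self)

lemma norm_scaleC [simp]:
  fixes x :: "'a::complex_inner"
  shows "norm (c *\<^sub>C x) = cmod c * norm x"
proof -
  have "complex_of_real ((norm (c *\<^sub>C x))\<^sup>2) = (c * cnj c) * cinner x x"
    unfolding cinner_self[symmetric] by (simp add: mult.assoc)
  also have "\<dots> = complex_of_real ((cmod c * norm x)\<^sup>2)"
    by (simp only: cinner_self complex_norm_square[symmetric] of_real_mult[symmetric] power_mult_distrib)
  finally have "complex_of_real ((norm (c *\<^sub>C x))\<^sup>2) = complex_of_real ((cmod c * norm x)\<^sup>2)" .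
  then show ?thesis
    by (simp only: of_real_eq_iff) (simp add: power2_eq_iff_nonneg)
qed

text \<open>Multiplying \<open>x\<close> by the unimodular scalar \<open>u\<close> makes
  \<open>cinner x y\<close> real and nonnegative without changing norms, so the real Cauchy-Schwarz
  inequality applies.\<close>

lemma cmod_cinner_le: "cmod (cinner x y) \<le> norm x * norm y"
proof (cases "cinner x y = 0")
  case False
  define u where "u = cnj (cinner x y) / complex_of_real (cmod (cinner x y))"
  have u: "u * cinner x y = cmod (cinner x y)"
    using False complex_norm_square[of "cinner x y"]
    by (simp add: u_def power2_eq_square field_simps)
  have "cmod u = 1" using False by (simp add: u_def norm_divide)
  have "cmod (cinner x y) = inner (u *\<^sub>C x) y"
    using u by (simp add: inner_eq_Re_cinner)
  also have "\<dots> \<le> norm (u *\<^sub>C x) * norm y" by (rule norm_cauchy_schwarz)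
  finally show ?thesis by (simp add: \<open>cmod u = 1\<close>)
qed simp

lemma bounded_linear_cinner_left: "bounded_linear (\<lambda>x. cinner x y)"
  by (rule bounded_linear_intro[where K = "norm y"])
    (simp_all add: cinner_add_left cmod_cinner_le scaleR_conv_of_real)

lemma bounded_ops_bounded_linear: "A \<in> bounded_ops UNIV \<Longrightarrow> bounded_linear A"
  by (simp add: bounded_ops_UNIV_iff)

lemma bounded_ops_scaleC: "A \<in> bounded_ops UNIV \<Longrightarrow> A (c *\<^sub>C x) = c *\<^sub>C A x"
  by (simp add: bounded_ops_UNIV_iff)

lemma closed_csubspace_orth_complement: "closed_csubspace (orth_complement Z)"
proof -
  have "closed {x. cinner x z = 0}" for z :: 'a
    using closed_Collect_eq[OF linear_continuous_on[OF bounded_linear_cinner_left, of UNIV z]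
        continuous_on_const[of _ 0]] by simp
  then have "closed (\<Inter>z\<in>Z. {x. cinner x z = 0})" by blast
  moreover have "orth_complement Z = (\<Inter>z\<in>Z. {x. cinner x z = 0})"
    by (auto simp: orth_complement_def)
  ultimately show ?thesis
    by (auto simp: closed_csubspace_def orth_complement_def complex_vector.subspace_def cinner_add_left)
qed

section \<open>Orthonormal families: Bessel's inequality and the Riesz-Fischer theorem\<close>

definition orthonormal :: "'a::complex_inner set \<Rightarrow> bool" where
  "orthonormal G \<longleftrightarrow> (\<forall>g\<in>G. norm g = 1) \<and> (\<forall>g\<in>G. \<forall>h\<in>G. g \<noteq> h \<longrightarrow> cinner g h = 0)"

lemma orthonormal_subset: "orthonormal G \<Longrightarrow> F \<subseteq> G \<Longrightarrow> orthonormal F"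
  by (auto simp: orthonormal_def)

lemma orthonormal_cinner:
  "orthonormal G \<Longrightarrow> g \<in> G \<Longrightarrow> h \<in> G \<Longrightarrow> cinner g h = (if g = h then 1 else 0)"
  by (auto simp: orthonormal_def cinner_self)

lemma orthonormal_norm_sum:
  assumes "orthonormal G" "finite F" "F \<subseteq> G"
  shows "(norm (\<Sum>g\<in>F. a g *\<^sub>C g))\<^sup>2 = (\<Sum>g\<in>F. (cmod (a g))\<^sup>2)"
proof -
  have "complex_of_real ((norm (\<Sum>g\<in>F. a g *\<^sub>C g))\<^sup>2)
      = (\<Sum>g\<in>F. \<Sum>h\<in>F. a g * (cnj (a h) * cinner g h))"
    unfolding cinner_self[symmetric] cinner_sum_left
    by (simp only: cinner_sum_right cinner_scaleC_left cinner_scaleC_right sum_distrib_left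
        mult.left_commute)
  also have "\<dots> = (\<Sum>g\<in>F. \<Sum>h\<in>F. if h = g then a g * cnj (a g) else 0)"
    using assms by (intro sum.cong) (auto simp: orthonormal_cinner[OF assms(1)] subset_iff)
  also have "\<dots> = complex_of_real (\<Sum>g\<in>F. (cmod (a g))\<^sup>2)"
    using assms by (simp add: complex_norm_square del: of_real_power)
  finally show ?thesis by (simp only: of_real_eq_iff)
qed

lemma orthonormal_cinner_sum:
  assumes "orthonormal G" "finite F" "F \<subseteq> G" "h \<in> G"
  shows "cinner (\<Sum>g\<in>F. a g *\<^sub>C g) h = (if h \<in> F then a h else 0)"
proof -
  have "cinner (\<Sum>g\<in>F. a g *\<^sub>C g) h = (\<Sum>g\<in>F. if g = h then a g else 0)"
    unfolding cinner_sum_left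
    using assms by (intro sum.cong) (auto simp: orthonormal_cinner[OF assms(1)] subset_iff)
  then show ?thesis using assms by simp
qed

text \<open>The partial expansion \<open>z\<close> satisfies \<open>cinner x z = s\<close> and
  \<open>(norm z)\<^sup>2 = s\<close>, so Cauchy-Schwarz gives
  \<open>norm z \<le> norm x\<close>.\<close>

lemma Bessel_finite:
  assumes "orthonormal G" "finite F" "F \<subseteq> G"
  shows "(\<Sum>g\<in>F. (cmod (cinner x g))\<^sup>2) \<le> (norm x)\<^sup>2"
proof -
  define z where "z = (\<Sum>g\<in>F. cinner x g *\<^sub>C g)"
  define s where "s = (\<Sum>g\<in>F. (cmod (cinner x g))\<^sup>2)"
  have "cinner x z = (\<Sum>g\<in>F. cnj (cinner x g) * cinner x g)"
    by (simp add: z_def cinner_sum_right)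
  also have "\<dots> = complex_of_real s"
    by (simp add: s_def complex_norm_square mult.commute del: of_real_power)
  finally have "cinner x z = complex_of_real s" .
  then have "s = cmod (cinner x z)"
    by (simp only: norm_of_real) (simp add: s_def sum_nonneg)
  also have "\<dots> \<le> norm x * norm z" by (rule cmod_cinner_le)
  finally have "s \<le> norm x * norm z" .
  moreover have "(norm z)\<^sup>2 = s"
    using orthonormal_norm_sum[OF assms, of "cinner x"] by (simp add: z_def s_def)
  ultimately have "norm z * norm z \<le> norm x * norm z" by (simp add: power2_eq_square)
  then have "norm z \<le> norm x" by (cases "z = 0") auto
  then have "(norm z)\<^sup>2 \<le> (norm x)\<^sup>2" by (simp add: power_mono)
  then show ?thesis using \<open>(norm z)\<^sup>2 = s\<close> by (simp add: s_def)
qed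

lemma Bessel_summable:
  assumes "orthonormal G"
  shows "(\<lambda>g. (cmod (cinner x g))\<^sup>2) summable_on G"
  by (rule nonneg_bdd_above_summable_on)
    (auto intro!: bdd_aboveI2[where M = "(norm x)\<^sup>2"] Bessel_finite[OF assms])

text \<open>By Pythagoras the square of the distance between nested partial sums is a difference of
  partial sums of the squared coefficients. Hence the net of partial sums is Cauchy, and
  completeness supplies a limit.\<close>

lemma Riesz_Fischer:
  fixes G :: "'a::chilbert_space set"
  assumes G: "orthonormal G" and a: "(\<lambda>g. (cmod (a g))\<^sup>2) summable_on G"
  shows "(\<lambda>g. a g *\<^sub>C g) summable_on G"
proof -
  define s where "s F = (\<Sum>g\<in>F. (cmod (a g))\<^sup>2)" for F
  define z where "z F = (\<Sum>g\<in>F. a g *\<^sub>C g)" for F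
  obtain L where L: "(s \<longlongrightarrow> L) (finite_subsets_at_top G)"
    using a by (auto simp: summable_on_def has_sum_def s_def[abs_def])
  have "\<exists>P. eventually P (finite_subsets_at_top G) \<and> (\<forall>F F'. P F \<and> P F' \<longrightarrow> dist (z F) (z F') < e)"
    if "e > 0" for e :: real
  proof -
    \<comment> \<open>Two values within \<open>e\<^sup>2 / 8\<close> of \<open>L\<close> differ by
      less than \<open>(e / 2)\<^sup>2\<close>; this leaves \<open>e / 2\<close> for each half of
      the final triangle inequality through \<open>z F0\<close>.\<close>
    have "eventually (\<lambda>F. dist (s F) L < e\<^sup>2 / 8) (finite_subsets_at_top G)"
      using L that by (intro tendstoD) auto
    then obtain F0 where F0: "finite F0" "F0 \<subseteq> G"
      and near: "\<And>F. finite F \<Longrightarrow> F0 \<subseteq> F \<Longrightarrow> F \<subseteq> G \<Longrightarrow> dist (s F) L < e\<^sup>2 / 8"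
      by (auto simp: eventually_finite_subsets_at_top)
    have *: "dist (z F) (z F0) < e / 2" if F: "finite F" "F0 \<subseteq> F" "F \<subseteq> G" for F
    proof -
      have "(norm (z F - z F0))\<^sup>2 = (norm (z (F - F0)))\<^sup>2"
        using F by (simp add: z_def sum_diff)
      also have "\<dots> = s (F - F0)"
        unfolding z_def s_def using F by (intro orthonormal_norm_sum[OF G]) auto
      also have "\<dots> = s F - s F0" using F by (simp add: s_def sum_diff)
      also have "\<dots> < e\<^sup>2 / 4"
        using near[OF F] near[OF F0(1) order_refl F0(2)]
        unfolding dist_real_def by linarith
      also have "e\<^sup>2 / 4 = (e / 2)\<^sup>2" by (simp add: power_divide)
      finally show ?thesis
        unfolding dist_norm using \<open>e > 0\<close> power2_less_imp_less[of _ "e / 2"] by auto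
    qed
    have "dist (z F) (z F') < e"
      if "finite F" "F0 \<subseteq> F" "F \<subseteq> G" "finite F'" "F0 \<subseteq> F'" "F' \<subseteq> G" for F F'
      using *[of F] *[of F'] that dist_triangle2[of "z F" "z F'" "z F0"] by linarith
    then show ?thesis
      using F0 by (intro exI[of _ "\<lambda>F. finite F \<and> F0 \<subseteq> F \<and> F \<subseteq> G"])
        (auto simp: eventually_finite_subsets_at_top)
  qed
  then have "cauchy_filter (filtermap z (finite_subsets_at_top G))"
    by (simp add: cauchy_filter_metric_filtermap)
  moreover have "complete (UNIV :: 'a set)"
    by (meson Cauchy_convergent UNIV_I complete_def convergent_def)
  ultimately obtain w where "(z \<longlongrightarrow> w) (finite_subsets_at_top G)"
    using complete_uniform[where S = UNIV] by (force simp: filterlim_def)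
  then show ?thesis
    by (auto simp: summable_on_def has_sum_def z_def[abs_def])
qed

lemma orthonormal_independent:
  assumes "orthonormal G"
  shows "complex_vector.independent G"
  unfolding complex_vector.independent_explicit_module
proof (intro allI impI)
  fix F u v assume F: "finite F" "F \<subseteq> G" and 0: "(\<Sum>w\<in>F. u w *\<^sub>C w) = 0" and v: "v \<in> F"
  have "cinner (\<Sum>w\<in>F. u w *\<^sub>C w) v = u v"
    using orthonormal_cinner_sum[OF assms F, of v u] F v by auto
  then show "u v = 0" by (simp add: 0)
qed

lemma cfinite_dim_orthonormal:
  assumes "cfinite_dim M" "orthonormal G" "G \<subseteq> M"
  shows "finite G"
proof -
  obtain B where "finite B" "G \<subseteq> complex_vector.span B"
    using assms unfolding cfinite_dim_def by blast
  then show ?thesis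
    using complex_vector.independent_span_bound orthonormal_independent[OF assms(2)] by blast
qed

section \<open>Orthonormal bases and diagonal operators\<close>

instance chilbert_space \<subseteq> banach ..

lemma is_adjoint_unique:
  assumes "is_adjoint UNIV A B" "is_adjoint UNIV A B'"
  shows "B = B'"
proof
  fix y
  have "cinner x (B y - B' y) = 0" for x
    using assms by (simp add: is_adjoint_def cinner_diff_right)
  then have "cinner (B y - B' y) (B y - B' y) = 0" .
  then show "B y = B' y" by simp
qed

lemma cadjoint_eqI: "is_adjoint UNIV A B \<Longrightarrow> cadjoint A = B"
  unfolding cadjoint_def by (rule the_equality, assumption) (rule is_adjoint_unique)

lemma orthonormal_coeff:
  assumes G: "orthonormal G" and p: "((\<lambda>g. a g *\<^sub>C g) has_sum p) G" and h: "h \<in> G"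
  shows "cinner p h = a h"
proof -
  have "((\<lambda>g. cinner (a g *\<^sub>C g) h) has_sum cinner p h) G"
    by (rule has_sum_bounded_linear[OF bounded_linear_cinner_left p])
  moreover have "((\<lambda>g. cinner (a g *\<^sub>C g) h) has_sum a h) G \<longleftrightarrow> ((\<lambda>g. a h) has_sum a h) {h}"
    using h by (intro has_sum_cong_neutral) (auto simp: orthonormal_cinner[OF G])
  ultimately show ?thesis
    using has_sum_finite[of "{h}" "\<lambda>g. a h"] by (auto intro: has_sum_unique)
qed

lemma orthonormal_expansion:
  fixes x :: "'a::chilbert_space"
  assumes "orthonormal G"
  obtains p where "((\<lambda>g. cinner x g *\<^sub>C g) has_sum p) G" "\<And>g. g \<in> G \<Longrightarrow> cinner p g = cinner x g"
proof -
  have "(\<lambda>g. cinner x g *\<^sub>C g) summable_on G"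
    using assms Bessel_summable Riesz_Fischer by blast
  then obtain p where "((\<lambda>g. cinner x g *\<^sub>C g) has_sum p) G"
    by (auto simp: summable_on_def)
  then show thesis using orthonormal_coeff[OF assms] that by blast
qed

text \<open>Completeness of the basis is encoded as triviality of its orthogonal complement. This is
  the form in which maximality delivers it, and it lets vectors be compared coefficient by
  coefficient.\<close>

locale onb =
  fixes G :: "'a::chilbert_space set"
  assumes orthonormal: "orthonormal G"
    and total: "\<And>x. (\<And>g. g \<in> G \<Longrightarrow> cinner x g = 0) \<Longrightarrow> x = 0"
begin

lemma eqI: "(\<And>g. g \<in> G \<Longrightarrow> cinner x g = cinner y g) \<Longrightarrow> x = y"
  using total[of "x - y"] by (simp add: cinner_diff_left)

lemma cinner_basis: "g \<in> G \<Longrightarrow> h \<in> G \<Longrightarrow> cinner g h = (if g = h then 1 else 0)"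
  by (rule orthonormal_cinner[OF orthonormal])

lemma norm_basis: "g \<in> G \<Longrightarrow> norm g = 1"
  using orthonormal by (simp add: orthonormal_def)

lemma expansion: "((\<lambda>g. cinner x g *\<^sub>C g) has_sum x) G"
proof (rule orthonormal_expansion[OF orthonormal, of x])
  fix p assume p: "((\<lambda>g. cinner x g *\<^sub>C g) has_sum p) G" "\<And>g. g \<in> G \<Longrightarrow> cinner p g = cinner x g"
  then have "p = x" by (intro eqI)
  then show ?thesis using p(1) by simp
qed

lemma expansion_image:
  assumes "A \<in> bounded_ops UNIV"
  shows "((\<lambda>g. cinner x g *\<^sub>C A g) has_sum A x) G"
  using has_sum_bounded_linear[OF bounded_ops_bounded_linear[OF assms] expansion[of x]]
  by (simp add: bounded_ops_scaleC[OF assms])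

lemma cinner_image_has_sum:
  assumes "A \<in> bounded_ops UNIV"
  shows "((\<lambda>g. cinner x g * cinner (A g) y) has_sum cinner (A x) y) G"
  using has_sum_bounded_linear[OF bounded_linear_cinner_left expansion_image[OF assms, of x]]
  by simp

lemma cinner_has_sum: "((\<lambda>g. cinner x g * cinner g y) has_sum cinner x y) G"
  using has_sum_bounded_linear[OF bounded_linear_cinner_left expansion[of x]] by simp

lemma Parseval: "((\<lambda>g. (cmod (cinner x g))\<^sup>2) has_sum (norm x)\<^sup>2) G"
proof -
  have "((\<lambda>g. Re (cinner x g * cinner g x)) has_sum Re (cinner x x)) G"
    by (rule has_sum_bounded_linear[OF bounded_linear_Re cinner_has_sum])
  moreover have "Re (cinner x g * cinner g x) = (cmod (cinner x g))\<^sup>2" for g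
    by (subst (2) cinner_commute) (simp add: cmod_def power2_eq_square)
  ultimately show ?thesis by (simp add: cinner_self)
qed

lemma ex_coeffs:
  assumes "(\<lambda>g. (cmod (a g))\<^sup>2) summable_on G"
  shows "\<exists>x. \<forall>g\<in>G. cinner x g = a g"
proof -
  obtain x where "((\<lambda>g. a g *\<^sub>C g) has_sum x) G"
    using Riesz_Fischer[OF orthonormal assms] by (auto simp: summable_on_def)
  then show ?thesis
    using orthonormal_coeff[OF orthonormal, of a x] by blast
qed

lemma bounded_op_eqI:
  assumes "A \<in> bounded_ops UNIV" "B \<in> bounded_ops UNIV" "\<And>g. g \<in> G \<Longrightarrow> A g = B g"
  shows "A = B"
proof
  fix x
  have "((\<lambda>g. cinner x g *\<^sub>C A g) has_sum B x) G"
    using expansion_image[OF assms(2), of x] assms(3) by (simp cong: has_sum_cong)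
  then show "A x = B x"
    using expansion_image[OF assms(1)] has_sum_unique by blast
qed

text \<open>The vector \<open>B y\<close> is built from its prescribed coefficients
  \<open>cinner y (A g)\<close>. The work lies in showing that these are square-summable, which
  follows from boundedness of \<open>A\<close>.\<close>

lemma ex_adjoint:
  fixes A :: "'a \<Rightarrow> 'a"
  assumes A: "A \<in> bounded_ops UNIV"
  shows "\<exists>B. is_adjoint UNIV A B"
proof -
  interpret A: bounded_linear A by (rule bounded_ops_bounded_linear[OF A])
  obtain K where K: "\<And>x. norm (A x) \<le> K * norm x"
    using A by (auto simp: bounded_ops_def)
  have "(\<lambda>g. (cmod (cinner y (A g)))\<^sup>2) summable_on G" for y
  proof (rule nonneg_bdd_above_summable_on)
    have "(\<Sum>g\<in>F. (cmod (cinner y (A g)))\<^sup>2) \<le> (norm y * K)\<^sup>2" if F: "finite F" "F \<subseteq> G" for F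
    proof -
      \<comment> \<open>This test vector makes both \<open>cinner y (A z)\<close> and
        \<open>(norm z)\<^sup>2\<close> equal to the sum \<open>s\<close> to be estimated, so that
        \<open>s \<le> norm y * K * norm z\<close> bounds \<open>norm z\<close>.\<close>
      define z where "z = (\<Sum>g\<in>F. cinner y (A g) *\<^sub>C g)"
      define s where "s = (\<Sum>g\<in>F. (cmod (cinner y (A g)))\<^sup>2)"
      have "cinner y (A z) = (\<Sum>g\<in>F. cinner y (A g) * cnj (cinner y (A g)))"
        by (simp add: z_def A.sum bounded_ops_scaleC[OF A] cinner_sum_right mult.commute)
      also have "\<dots> = complex_of_real s"
        by (simp add: s_def complex_norm_square del: of_real_power)
      finally have "cinner y (A z) = complex_of_real s" .
      then have "s = cmod (cinner y (A z))"
        by (simp only: norm_of_real) (simp add: s_def sum_nonneg)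
      also have "\<dots> \<le> norm y * (K * norm z)"
        by (rule order_trans[OF cmod_cinner_le]) (simp add: K mult_left_mono)
      finally have s: "s \<le> norm y * K * norm z" by (simp add: mult.assoc)
      have z: "(norm z)\<^sup>2 = s"
        using orthonormal_norm_sum[OF orthonormal F] by (simp add: z_def s_def)
      have "norm z \<le> norm y * K \<or> norm z = 0"
        using s z by (cases "norm z = 0") (auto simp: power2_eq_square)
      then have "(norm z)\<^sup>2 \<le> (norm y * K)\<^sup>2" by (auto intro: power_mono)
      then show ?thesis using z by (simp add: s_def)
    qed
    then show "bdd_above (sum (\<lambda>g. (cmod (cinner y (A g)))\<^sup>2) ` {F. F \<subseteq> G \<and> finite F})"
      by (auto intro!: bdd_aboveI2[where M = "(norm y * K)\<^sup>2"])
  qed auto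
  then have "\<forall>y. \<exists>z. \<forall>g\<in>G. cinner z g = cinner y (A g)"
    using ex_coeffs by simp
  then obtain B where B: "\<And>y g. g \<in> G \<Longrightarrow> cinner (B y) g = cinner y (A g)"
    by metis
  have adj: "cinner (A x) y = cinner x (B y)" for x y
  proof -
    have "cinner (A g) y = cinner g (B y)" if "g \<in> G" for g
      using B[OF that, of y] by (metis cinner_commute)
    then have "((\<lambda>g. cinner x g * cinner g (B y)) has_sum cinner (A x) y) G"
      using cinner_image_has_sum[OF A, of x y] by (simp cong: has_sum_cong)
    then show ?thesis using cinner_has_sum has_sum_unique by blast
  qed
  have "B (x + y) = B x + B y" for x y
    by (rule eqI) (simp add: B cinner_add_left)
  moreover have "B (c *\<^sub>C x) = c *\<^sub>C B x" for c x
    by (rule eqI) (simp add: B)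
  moreover have "norm (B y) \<le> K * norm y" for y
  proof -
    have "complex_of_real ((norm (B y))\<^sup>2) = cinner (A (B y)) y"
      by (simp add: adj cinner_self)
    then have "(norm (B y))\<^sup>2 = cmod (cinner (A (B y)) y)"
      by (metis norm_of_real abs_of_nonneg zero_le_power2)
    also have "\<dots> \<le> K * norm (B y) * norm y"
      by (rule order_trans[OF cmod_cinner_le]) (simp add: K mult_right_mono)
    finally have "norm (B y) \<le> K * norm y \<or> B y = 0"
      by (auto simp: power2_eq_square)
    \<comment> \<open>No sign of \<open>K\<close> is known; the bound on \<open>A y\<close> yields
      this inequality, which settles the case \<open>B y = 0\<close>.\<close>
    moreover have "0 \<le> K * norm y" by (rule order_trans[OF _ K]) simp
    ultimately show ?thesis by auto
  qed
  ultimately have "B \<in> bounded_ops UNIV" by (auto simp: bounded_ops_def)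
  then show ?thesis using adj by (auto simp: is_adjoint_def)
qed

lemma is_adjoint_cadjoint:
  fixes A :: "'a \<Rightarrow> 'a"
  assumes "A \<in> bounded_ops UNIV"
  shows "is_adjoint UNIV A (cadjoint A)"
  using ex_adjoint[OF assms] cadjoint_eqI[of A] by blast

section \<open>Diagonal operators\<close>

text \<open>The infinite sum defaults to 0 where it does not converge, so the facts below carry the
  hypothesis that \<open>f\<close> is bounded on \<open>G\<close>.\<close>

definition diag :: "('a \<Rightarrow> complex) \<Rightarrow> 'a \<Rightarrow> 'a" where
  "diag f x = (\<Sum>\<^sub>\<infinity>g\<in>G. (f g * cinner x g) *\<^sub>C g)"

context
  fixes f :: "'a \<Rightarrow> complex"
  assumes f: "bounded (f ` G)"
begin

lemma cinner_diag: "h \<in> G \<Longrightarrow> cinner (diag f x) h = f h * cinner x h"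
proof -
  assume "h \<in> G"
  obtain K where K: "\<And>g. g \<in> G \<Longrightarrow> cmod (f g) \<le> K"
    using f by (auto simp: bounded_iff)
  have "(\<lambda>g. (cmod (f g * cinner x g))\<^sup>2) summable_on G"
  proof (rule summable_on_comparison_test)
    show "(\<lambda>g. K\<^sup>2 * (cmod (cinner x g))\<^sup>2) summable_on G"
      by (intro summable_on_cmult_right Bessel_summable orthonormal)
    show "(cmod (f g * cinner x g))\<^sup>2 \<le> K\<^sup>2 * (cmod (cinner x g))\<^sup>2" if "g \<in> G" for g
      using K[OF that] by (simp add: norm_mult power_mult_distrib mult_right_mono power_mono)
  qed auto
  then have "((\<lambda>g. (f g * cinner x g) *\<^sub>C g) has_sum diag f x) G"
    unfolding diag_def by (intro has_sum_infsum Riesz_Fischer orthonormal)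
  then show ?thesis
    by (rule orthonormal_coeff[OF orthonormal _ \<open>h \<in> G\<close>])
qed

lemma diag_bounded_ops: "diag f \<in> bounded_ops UNIV"
proof -
  obtain K where K: "\<And>g. g \<in> G \<Longrightarrow> cmod (f g) \<le> K" "0 < K"
    using f by (auto simp: bounded_pos)
  have "norm (diag f x) \<le> K * norm x" for x
  proof -
    have "(norm (diag f x))\<^sup>2 \<le> K\<^sup>2 * (norm x)\<^sup>2"
    proof (rule has_sum_mono[OF Parseval has_sum_cmult_right[OF Parseval]])
      show "(cmod (cinner (diag f x) g))\<^sup>2 \<le> K\<^sup>2 * (cmod (cinner x g))\<^sup>2" if "g \<in> G" for g
        using K(1)[OF that]
        by (simp add: that cinner_diag norm_mult power_mult_distrib mult_right_mono power_mono)
    qed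
    then have "(norm (diag f x))\<^sup>2 \<le> (K * norm x)\<^sup>2" by (simp add: power_mult_distrib)
    then show ?thesis using K(2) by (auto intro: power2_le_imp_le)
  qed
  moreover have "diag f (x + y) = diag f x + diag f y" for x y
    by (rule eqI) (simp add: cinner_diag cinner_add_left algebra_simps)
  moreover have "diag f (c *\<^sub>C x) = c *\<^sub>C diag f x" for c x
    by (rule eqI) (simp add: cinner_diag)
  ultimately show ?thesis by (auto simp: bounded_ops_def)
qed

lemma diag_basis: "g \<in> G \<Longrightarrow> diag f g = f g *\<^sub>C g"
  by (rule eqI) (simp add: cinner_diag cinner_basis)

lemma is_adjoint_diag: "is_adjoint UNIV (diag f) (diag (\<lambda>g. cnj (f g)))"
proof -
  have cf: "bounded ((\<lambda>g. cnj (f g)) ` G)"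
    using f by (simp add: bounded_iff)
  have "cinner (diag f x) y = cinner x (diag (\<lambda>g. cnj (f g)) y)" for x y
  proof -
    have *: "cinner (diag f x) g * cinner g y = cinner x g * cinner g (diag (\<lambda>g. cnj (f g)) y)"
      if "g \<in> G" for g
    proof -
      have "cinner g (diag (\<lambda>g. cnj (f g)) y) = cnj (cnj (f g) * cinner y g)"
        using onb.cinner_diag[OF onb_axioms cf that] cinner_commute by metis
      also have "\<dots> = f g * cinner g y" by (simp add: cinner_commute[of g y])
      finally show ?thesis by (simp add: that cinner_diag)
    qed
    show ?thesis
      using cinner_has_sum[of "diag f x" y] cinner_has_sum[of x "diag (\<lambda>g. cnj (f g)) y"] *
      by (auto cong: has_sum_cong intro: has_sum_unique)
  qed
  then show ?thesis
    using onb.diag_bounded_ops[OF onb_axioms cf] by (simp add: is_adjoint_def)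
qed

text \<open>Shifts by scalars stay diagonal, so questions about the spectrum and the Fredholm
  property become questions about zeros and lower bounds of \<open>f g - c\<close>.\<close>

lemma minus_scalar_diag: "minus_scalar (diag f) c = diag (\<lambda>g. f g - c)"
proof
  fix x
  have "bounded ((\<lambda>g. f g - c) ` G)"
    using bounded_translation_minus[OF f, of c] by (simp add: image_image)
  then show "minus_scalar (diag f) c x = diag (\<lambda>g. f g - c) x"
    by (intro eqI)
      (simp add: minus_scalar_def cinner_diff_left cinner_diag onb.cinner_diag[OF onb_axioms]
        algebra_simps)
qed

end

lemma diag_diag:
  assumes "bounded (f ` G)" "bounded (h ` G)"
  shows "diag f (diag h x) = diag (\<lambda>g. f g * h g) x"
proof -
  obtain K L where "\<And>g. g \<in> G \<Longrightarrow> cmod (f g) \<le> K" "\<And>g. g \<in> G \<Longrightarrow> cmod (h g) \<le> L" "0 < K"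
    using assms by (auto simp: bounded_pos)
  then have "\<And>g. g \<in> G \<Longrightarrow> cmod (f g * h g) \<le> K * L"
    by (simp add: norm_mult mult_mono)
  then have "bounded ((\<lambda>g. f g * h g) ` G)"
    by (auto simp: bounded_iff)
  then show ?thesis
    by (intro eqI) (simp add: cinner_diag assms mult.assoc)
qed

section \<open>Subspaces spanned by parts of the basis\<close>

text \<open>This is the closed span of \<open>G \<inter> A\<close>, described by vanishing
  coefficients; elements of \<open>A\<close> outside \<open>G\<close> have no effect. In this form
  it is an orthogonal complement, hence visibly a closed subspace.\<close>

definition supported :: "'a set \<Rightarrow> 'a set" where
  "supported A = {x. \<forall>g\<in>G - A. cinner x g = 0}"

lemma basis_supported: "g \<in> G \<Longrightarrow> g \<in> A \<Longrightarrow> g \<in> supported A"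
  by (auto simp: supported_def cinner_basis)

lemma closed_csubspace_supported: "closed_csubspace (supported A)"
  using closed_csubspace_orth_complement[of "G - A"] by (simp add: orth_complement_def supported_def)

lemma supported_orthogonal:
  assumes "x \<in> supported A" "y \<in> supported B" "G \<inter> A \<inter> B = {}"
  shows "cinner x y = 0"
proof -
  have "cinner x g * cinner g y = 0" if "g \<in> G" for g
    using that assms cinner_eq_0_commute[of g y] by (auto simp: supported_def)
  then have "((\<lambda>g. 0) has_sum cinner x y) G"
    using cinner_has_sum[of x y] has_sum_cong[of G "\<lambda>g. cinner x g * cinner g y" "\<lambda>g. 0"] by blast
  then show ?thesis by (rule has_sum_unique) simp
qed

lemma orth_complement_supported: "orth_complement (supported A) = supported (G - A)"
proof
  show "orth_complement (supported A) \<subseteq> supported (G - A)"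
    by (auto simp: orth_complement_def supported_def[of "G - A"] intro: basis_supported)
  show "supported (G - A) \<subseteq> orth_complement (supported A)"
    by (auto simp: orth_complement_def intro: supported_orthogonal)
qed

lemma supported_finite:
  assumes "finite (G \<inter> A)" "x \<in> supported A"
  shows "x = (\<Sum>g\<in>G \<inter> A. cinner x g *\<^sub>C g)"
proof (rule eqI)
  fix h assume "h \<in> G"
  then show "cinner x h = cinner (\<Sum>g\<in>G \<inter> A. cinner x g *\<^sub>C g) h"
    using assms orthonormal_cinner_sum[OF orthonormal assms(1) Int_lower1, of h "cinner x"]
    by (simp add: supported_def)
qed

lemma cfinite_dim_supported:
  assumes "finite (G \<inter> A)"
  shows "cfinite_dim (supported A)"
proof -
  have "x \<in> complex_vector.span (G \<inter> A)" if "x \<in> supported A" for x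
    by (subst supported_finite[OF assms that])
      (intro complex_vector.span_sum complex_vector.span_scale complex_vector.span_base)
  then show ?thesis using assms by (auto simp: cfinite_dim_def)
qed

text \<open>The basis expansion of a vector is regrouped into blocks; the sum over each block is the
  component in the corresponding summand.\<close>

lemma is_orth_sum_supported:
  assumes A: "G \<inter> A = (\<Union>i\<in>I. G \<inter> B i)" and disj: "\<And>i j. i \<in> I \<Longrightarrow> j \<in> I \<Longrightarrow> i \<noteq> j \<Longrightarrow> B i \<inter> B j = {}"
  shows "is_orth_sum (supported A) I (\<lambda>i. supported (B i))"
  unfolding is_orth_sum_def
proof (intro conjI ballI impI)
  show "cinner x y = 0"
    if "i \<in> I" "j \<in> I" "i \<noteq> j" "x \<in> supported (B i)" "y \<in> supported (B j)" for i j x y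
    using that disj by (auto intro: supported_orthogonal)
  show "supported A = {y. \<exists>x. (\<forall>i\<in>I. x i \<in> supported (B i)) \<and> (x has_sum y) I}"
  proof (intro equalityI subsetI CollectI)
    fix y assume y: "y \<in> supported A"
    have "\<exists>p. ((\<lambda>g. cinner y g *\<^sub>C g) has_sum p) (G \<inter> B i) \<and> p \<in> supported (B i)" for i
    proof -
      have "(\<lambda>g. cinner y g *\<^sub>C g) summable_on (G \<inter> B i)"
        by (intro Riesz_Fischer Bessel_summable orthonormal_subset[OF orthonormal]) auto
      then obtain p where p: "((\<lambda>g. cinner y g *\<^sub>C g) has_sum p) (G \<inter> B i)"
        by (auto simp: summable_on_def)
      \<comment> \<open>Padding the block with zero coefficients turns it into a sum over all of
        \<open>G\<close>, from which every coefficient of \<open>p\<close> can be read off.\<close>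
      also have "?this \<longleftrightarrow> ((\<lambda>g. (if g \<in> B i then cinner y g else 0) *\<^sub>C g) has_sum p) G"
        by (rule has_sum_cong_neutral) auto
      finally have "p \<in> supported (B i)"
        using orthonormal_coeff[OF orthonormal, of _ p] by (force simp: supported_def)
      then show ?thesis using p by blast
    qed
    then obtain x where x: "\<And>i. ((\<lambda>g. cinner y g *\<^sub>C g) has_sum x i) (G \<inter> B i)"
      "\<And>i. x i \<in> supported (B i)" by metis
    have "((\<lambda>g. cinner y g *\<^sub>C g) has_sum y) (G \<inter> A) \<longleftrightarrow> ((\<lambda>g. cinner y g *\<^sub>C g) has_sum y) G"
      using y by (intro has_sum_cong_neutral) (auto simp: supported_def)
    \<comment> \<open>By disjointness of the blocks, \<open>snd\<close> identifies their disjoint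
      union with \<open>G \<inter> A\<close>; the expansion then becomes an iterated sum.\<close>
    moreover have "snd ` Sigma I (\<lambda>i. G \<inter> B i) = G \<inter> A"
      unfolding A by force
    moreover have "inj_on snd (Sigma I (\<lambda>i. G \<inter> B i))"
      using disj by (force simp: inj_on_def)
    ultimately have "(((\<lambda>g. cinner y g *\<^sub>C g) \<circ> snd) has_sum y) (Sigma I (\<lambda>i. G \<inter> B i))"
      using expansion[of y] by (simp flip: has_sum_reindex)
    then have "(x has_sum y) I"
      by (rule has_sum_SigmaD) (simp add: x)
    then show "\<exists>x. (\<forall>i\<in>I. x i \<in> supported (B i)) \<and> (x has_sum y) I"
      using x by blast
  next
    fix y assume "y \<in> {y. \<exists>x. (\<forall>i\<in>I. x i \<in> supported (B i)) \<and> (x has_sum y) I}"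
    then obtain x where x: "\<And>i. i \<in> I \<Longrightarrow> x i \<in> supported (B i)" "(x has_sum y) I" by blast
    have "cinner y g = 0" if g: "g \<in> G - A" for g
    proof -
      have "((\<lambda>i. cinner (x i) g) has_sum cinner y g) I"
        by (rule has_sum_bounded_linear[OF bounded_linear_cinner_left x(2)])
      moreover have "cinner (x i) g = 0" if "i \<in> I" for i
        using x(1)[OF that] g that A by (auto simp: supported_def)
      ultimately have "((\<lambda>i. 0) has_sum cinner y g) I" by (simp cong: has_sum_cong)
      then show ?thesis by (rule has_sum_unique) simp
    qed
    then show "y \<in> supported A" by (simp add: supported_def)
  qed
qed (rule closed_csubspace_supported)

lemma supported_UNIV: "supported UNIV = UNIV"
  by (simp add: supported_def)

lemma null_space_diag:
  assumes "bounded (f ` G)"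
  shows "null_space (diag f) = supported {g. f g = 0}"
proof -
  have "diag f x = 0 \<longleftrightarrow> (\<forall>g\<in>G. f g * cinner x g = 0)" for x
    using cinner_diag[OF assms] total[of "diag f x"] by (metis cinner_zero_left)
  then show ?thesis by (auto simp: null_space_def supported_def)
qed

end

lemma norm_add_power2:
  fixes x y :: "'a::complex_inner"
  shows "(norm (x + y))\<^sup>2 = (norm x)\<^sup>2 + (norm y)\<^sup>2 + 2 * Re (cinner x y)"
  by (simp add: power2_norm_eq_inner inner_add_left inner_add_right inner_commute[of y x]
      flip: inner_eq_Re_cinner)

text \<open>Polarization: reality of the quadratic form at \<open>x + y\<close> compares the
  imaginary parts of \<open>cinner (Q x) y\<close> and \<open>cinner (Q y) x\<close>, and reality at
  \<open>x + \<i> *\<^sub>C y\<close> compares their real parts.\<close>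

lemma positive_op_self_adjoint:
  assumes Q: "positive_op Q"
  shows "cinner (Q x) y = cinner x (Q y)"
proof -
  interpret bounded_linear Q
    using Q by (simp add: positive_op_def bounded_ops_bounded_linear)
  have sc: "Q (c *\<^sub>C x) = c *\<^sub>C Q x" for c x
    using Q by (simp add: positive_op_def bounded_ops_scaleC)
  have im: "Im (cinner (Q x) x) = 0" for x
    using Q by (simp add: positive_op_def)
  have "Im (cinner (Q x) y) + Im (cinner (Q y) x) = 0"
    using im[of "x + y"] im[of x] im[of y] by (simp add: add cinner_add_left cinner_add_right)
  moreover have "Re (cinner (Q y) x) - Re (cinner (Q x) y) = 0"
    using im[of "x + \<i> *\<^sub>C y"] im[of x] im[of y]
    by (simp add: add sc cinner_add_left cinner_add_right)
  ultimately have "cinner (Q x) y = cnj (cinner (Q y) x)"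
    by (simp add: complex_eq_iff)
  then show ?thesis by (metis cinner_commute)
qed

section \<open>Spectrum and Fredholm property of diagonal operators\<close>

context onb
begin

lemma in_spectrum_diag:
  assumes f: "bounded (f ` G)" and g: "g \<in> G" "f g = c"
  shows "c \<in> spectrum (diag f)"
proof (rule ccontr)
  assume "c \<notin> spectrum (diag f)"
  then obtain B where B: "B \<in> bounded_ops UNIV" "B \<circ> minus_scalar (diag f) c = id"
    by (auto simp: spectrum_def)
  have "minus_scalar (diag f) c g = 0"
    by (simp add: minus_scalar_def diag_basis[OF f] g)
  then have "g = B 0" using B(2) by (metis comp_apply id_apply)
  also have "\<dots> = 0" by (simp add: linear_simps(3)[OF bounded_ops_bounded_linear[OF B(1)]])
  finally show False using norm_basis[OF g(1)] by simp
qed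

lemma bounded_inverse_on:
  fixes \<delta> :: real
  assumes "\<delta> > 0" "\<And>g. g \<in> G \<Longrightarrow> f g \<noteq> 0 \<Longrightarrow> \<delta> \<le> cmod (f g)"
  shows "bounded ((\<lambda>g. inverse (f g)) ` G)"
proof -
  have "cmod (inverse (f g)) \<le> inverse \<delta>" if "g \<in> G" for g
  proof (cases "f g = 0")
    case False
    then show ?thesis
      using assms(1) assms(2)[OF that False] by (simp add: norm_inverse le_imp_inverse_le)
  qed (use assms(1) in simp)
  then show ?thesis by (auto simp: bounded_iff)
qed

text \<open>Because \<open>inverse 0 = 0\<close>, the diagonal of inverses is a pseudo-inverse,
  inverting \<open>diag f\<close> off its kernel. If \<open>f\<close> has no zeros on
  \<open>G\<close> this is a genuine inverse; in general it shows that the range is closed.\<close>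

lemma diag_diag_inverse:
  fixes \<delta> :: real
  assumes f: "bounded (f ` G)" and \<delta>: "\<delta> > 0" "\<And>g. g \<in> G \<Longrightarrow> f g \<noteq> 0 \<Longrightarrow> \<delta> \<le> cmod (f g)"
    and x: "x \<in> supported {g. f g \<noteq> 0}"
  shows "diag f (diag (\<lambda>g. inverse (f g)) x) = x" "diag (\<lambda>g. inverse (f g)) (diag f x) = x"
  using x by (auto intro!: eqI simp: cinner_diag[OF f] cinner_diag[OF bounded_inverse_on[OF \<delta>]]
      supported_def)

lemma notin_spectrum_diag:
  fixes \<delta> :: real
  assumes f: "bounded (f ` G)" and \<delta>: "\<delta> > 0" "\<And>g. g \<in> G \<Longrightarrow> \<delta> \<le> cmod (f g - c)"
  shows "c \<notin> spectrum (diag f)"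
proof -
  have b: "bounded ((\<lambda>g. f g - c) ` G)"
    using bounded_translation_minus[OF f, of c] by (simp add: image_image)
  have "x \<in> supported {g. f g - c \<noteq> 0}" for x
    using \<delta> by (force simp: supported_def)
  note inv = diag_diag_inverse[OF b \<delta>(1) \<delta>(2) this]
  have "diag (\<lambda>g. inverse (f g - c)) \<in> bounded_ops UNIV"
    by (rule diag_bounded_ops[OF bounded_inverse_on[OF \<delta>(1) \<delta>(2)]])
  then show ?thesis
    unfolding spectrum_def minus_scalar_diag[OF f]
    using inv by (auto simp: fun_eq_iff intro!: bexI[of _ "diag (\<lambda>g. inverse (f g - c))"])
qed

text \<open>The gap around 0 makes the range equal to the orthogonal complement of the kernel. The
  adjoint has the conjugate entries, hence the same finite-dimensional kernel.\<close>

lemma fredholm_diag: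
  fixes \<delta> :: real
  assumes f: "bounded (f ` G)" and fin: "finite {g \<in> G. f g = 0}"
    and \<delta>: "\<delta> > 0" "\<And>g. g \<in> G \<Longrightarrow> f g \<noteq> 0 \<Longrightarrow> \<delta> \<le> cmod (f g)"
  shows "fredholm (diag f)"
proof -
  have cf: "bounded ((\<lambda>g. cnj (f g)) ` G)"
    using f by (simp add: bounded_iff)
  have "diag f x \<in> supported {g. f g \<noteq> 0}" for x
    by (simp add: supported_def cinner_diag[OF f])
  moreover have "x \<in> range (diag f)" if "x \<in> supported {g. f g \<noteq> 0}" for x
    using diag_diag_inverse(1)[OF f \<delta> that] by (metis rangeI)
  ultimately have "range (diag f) = supported {g. f g \<noteq> 0}" by auto
  then have "closed (range (diag f))"
    using closed_csubspace_supported by (simp add: closed_csubspace_def)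
  moreover have "cadjoint (diag f) = diag (\<lambda>g. cnj (f g))"
    by (rule cadjoint_eqI[OF is_adjoint_diag[OF f]])
  moreover have "finite (G \<inter> {g. f g = 0})" using fin by (simp add: Int_def)
  ultimately show ?thesis
    by (simp add: fredholm_def null_space_diag f cf cfinite_dim_supported)
qed

text \<open>The vector \<open>\<Sum>k. f (h k) h k\<close>, for a sequence \<open>h\<close> in the basis along which \<open>f\<close> decays
  geometrically, lies in the closure of the range, but the coefficients of a preimage along \<open>h\<close>
  would all be \<open>1\<close>, against Bessel's inequality.\<close>

lemma not_fredholm_diag:
  assumes f: "bounded (f ` G)" and inf: "\<And>e::real. e > 0 \<Longrightarrow> infinite {g \<in> G. cmod (f g) < e}"
  shows "\<not> fredholm (diag f)"
proof
  assume fred: "fredholm (diag f)"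
  interpret bounded_linear "diag f" by (rule bounded_ops_bounded_linear[OF diag_bounded_ops[OF f]])
  have "cfinite_dim (supported {g. f g = 0})"
    using fred by (simp add: fredholm_def null_space_diag[OF f])
  then have fin: "finite {g \<in> G. f g = 0}"
    by (rule cfinite_dim_orthonormal) (auto intro: orthonormal_subset[OF orthonormal] basis_supported)
  have ex: "\<exists>g\<in>G. f g \<noteq> 0 \<and> cmod (f g) < e" if "e > 0" for e
  proof -
    have "infinite ({g \<in> G. cmod (f g) < e} - {g \<in> G. f g = 0})"
      using inf[OF that] fin by simp
    then obtain g where "g \<in> {g \<in> G. cmod (f g) < e} - {g \<in> G. f g = 0}"
      by (metis finite.emptyI ex_in_conv)
    then show ?thesis by blast
  qed
  \<comment> \<open>The bound \<open>(1/2) ^ k\<close> makes the series below converge, strict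
    decrease makes \<open>h\<close> injective, and \<open>f (h k) \<noteq> 0\<close> allows division
    when the coefficients of a preimage are computed.\<close>
  have "\<exists>h. \<forall>k. (h k \<in> G \<and> f (h k) \<noteq> 0 \<and> cmod (f (h k)) < (1/2) ^ k)
      \<and> cmod (f (h (Suc k))) < cmod (f (h k))"
  proof (rule dependent_nat_choice)
    show "\<exists>g. g \<in> G \<and> f g \<noteq> 0 \<and> cmod (f g) < (1/2) ^ 0" using ex[of 1] by auto
  next
    fix g k assume "g \<in> G \<and> f g \<noteq> 0 \<and> cmod (f g) < (1/2) ^ k"
    then show "\<exists>h. (h \<in> G \<and> f h \<noteq> 0 \<and> cmod (f h) < (1/2) ^ Suc k) \<and> cmod (f h) < cmod (f g)"
      using ex[of "min ((1/2) ^ Suc k) (cmod (f g))"] by auto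
  qed
  then obtain h where h: "\<And>k. h k \<in> G" "\<And>k. f (h k) \<noteq> 0" "\<And>k. cmod (f (h k)) < (1/2) ^ k"
    and dec: "\<And>k. cmod (f (h (Suc k))) < cmod (f (h k))" by blast
  have "strict_mono (\<lambda>k. - cmod (f (h k)))"
    using dec by (simp add: strict_mono_Suc_iff)
  then have "inj h"
    by (metis (mono_tags, lifting) injI strict_mono_eq)
  have "summable (\<lambda>k. f (h k) *\<^sub>C h k)"
  proof (rule summable_comparison_test)
    show "\<exists>N. \<forall>k\<ge>N. norm (f (h k) *\<^sub>C h k) \<le> (1/2) ^ k"
      using h by (auto simp: norm_basis less_imp_le)
    show "summable (\<lambda>k. (1/2 :: real) ^ k)" by (rule summable_geometric) simp
  qed
  then obtain y where y: "(\<lambda>k. f (h k) *\<^sub>C h k) sums y" by blast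
  have "(\<Sum>k<n. f (h k) *\<^sub>C h k) = diag f (\<Sum>k<n. h k)" for n
    by (simp add: sum diag_basis[OF f] h)
  then have ran: "(\<Sum>k<n. f (h k) *\<^sub>C h k) \<in> range (diag f)" for n by simp
  have "closed (range (diag f))" using fred by (simp add: fredholm_def)
  then have "y \<in> range (diag f)"
    using closed_sequentially[of "range (diag f)" "\<lambda>n. \<Sum>k<n. f (h k) *\<^sub>C h k" y]
      ran y by (simp add: sums_def)
  then obtain x where x: "y = diag f x" by blast
  have coeff: "cinner x (h j) = 1" for j
  proof -
    have "(\<lambda>k. cinner (f (h k) *\<^sub>C h k) (h j)) sums cinner y (h j)"
      by (rule bounded_linear.sums[OF bounded_linear_cinner_left y])
    moreover have "(\<lambda>k. cinner (f (h k) *\<^sub>C h k) (h j)) = (\<lambda>k. if k = j then f (h j) else 0)"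
      using h(1) \<open>inj h\<close> by (auto simp: cinner_basis inj_eq)
    ultimately have "(\<lambda>k. if k = j then f (h j) else 0) sums cinner y (h j)" by simp
    then have "cinner y (h j) = f (h j)"
      using sums_single[of j "\<lambda>_. f (h j)"] sums_unique2 by blast
    then show ?thesis using h by (simp add: x cinner_diag[OF f])
  qed
  have "real n \<le> (norm x)\<^sup>2" for n
  proof -
    have "(\<Sum>g\<in>h ` {..<n}. (cmod (cinner x g))\<^sup>2) \<le> (norm x)\<^sup>2"
      using h by (intro Bessel_finite[OF orthonormal]) auto
    moreover have "(\<Sum>g\<in>h ` {..<n}. (cmod (cinner x g))\<^sup>2) = real n"
      using \<open>inj h\<close> by (subst sum.reindex) (auto simp: coeff inj_on_def inj_def)
    ultimately show ?thesis by simp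
  qed
  then show False by (meson not_le reals_Archimedean2)
qed

end

section \<open>Operators whose Gram operator is diagonal\<close>

text \<open>The equation \<open>eigen\<close> says weakly that \<open>g\<close> is an eigenvector of
  \<open>T\<^sup>* T\<close>. It avoids the adjoint, whose existence is only derived once an
  orthonormal basis is available.\<close>

locale eigen_onb = onb G for G :: "'a::chilbert_space set" +
  fixes T :: "'a \<Rightarrow> 'a"
  assumes T: "T \<in> bounded_ops UNIV"
    and eigen: "\<And>g y. g \<in> G \<Longrightarrow> cinner (T g) (T y) = complex_of_real ((norm (T g))\<^sup>2) * cinner g y"
begin

sublocale T: bounded_linear T by (rule bounded_ops_bounded_linear[OF T])

lemma adjoint: "cinner (T x) y = cinner x (cadjoint T y)"
  using is_adjoint_cadjoint[OF T] by (simp add: is_adjoint_def)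

lemma adjoint': "cinner (cadjoint T x) y = cinner x (T y)"
  by (metis adjoint cinner_commute)

lemma cadjoint_bounded_ops: "cadjoint T \<in> bounded_ops UNIV"
  using is_adjoint_cadjoint[OF T] by (simp add: is_adjoint_def)

lemma gram_eigen: "g \<in> G \<Longrightarrow> cadjoint T (T g) = complex_of_real ((norm (T g))\<^sup>2) *\<^sub>C g"
  by (rule eqI) (simp only: adjoint' eigen cinner_scaleC_left)

abbreviation modulus :: "'a \<Rightarrow> complex" where
  "modulus g \<equiv> complex_of_real (norm (T g))"

lemma norm_T_basis_le: "g \<in> G \<Longrightarrow> norm (T g) \<le> onorm T"
  using onorm[OF T.bounded_linear_axioms, of g] by (simp add: norm_basis)

lemma bounded_modulus: "bounded (modulus ` G)"
  using norm_T_basis_le by (auto simp: bounded_iff)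

lemma positive_op_diag_modulus: "positive_op (diag modulus)"
proof -
  have "Im (cinner (diag modulus x) x) = 0 \<and> 0 \<le> Re (cinner (diag modulus x) x)" for x
  proof -
    have eq: "cinner (diag modulus x) g * cinner g x
        = complex_of_real (norm (T g) * (cmod (cinner x g))\<^sup>2)" if "g \<in> G" for g
      unfolding cinner_diag[OF bounded_modulus that] of_real_mult complex_norm_square
      by (subst (2) cinner_commute) (simp add: mult.assoc)
    have "((\<lambda>g. complex_of_real (norm (T g) * (cmod (cinner x g))\<^sup>2)) has_sum
        cinner (diag modulus x) x) G"
      using cinner_has_sum[of "diag modulus x" x]
      by (rule has_sum_cong[THEN iffD1, rotated]) (rule eq)
    note sum = has_sum_bounded_linear[OF bounded_linear_Re this]
      has_sum_bounded_linear[OF bounded_linear_Im this]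
    have "0 \<le> Re (cinner (diag modulus x) x)"
      by (rule has_sum_nonneg[OF sum(1)]) simp
    moreover have "Im (cinner (diag modulus x) x) = 0"
      by (rule has_sum_unique[OF sum(2)]) simp
    ultimately show ?thesis by simp
  qed
  then show ?thesis by (simp add: positive_op_def diag_bounded_ops[OF bounded_modulus])
qed

lemma cadjoint_T_comp:
  "cadjoint T \<circ> T = diag (\<lambda>g. complex_of_real ((norm (T g))\<^sup>2))"
proof (rule bounded_op_eqI)
  have bl: "bounded_linear (cadjoint T \<circ> T)"
    using bounded_linear_compose[OF bounded_ops_bounded_linear[OF cadjoint_bounded_ops]
        bounded_ops_bounded_linear[OF T]] by (simp add: comp_def)
  then show "cadjoint T \<circ> T \<in> bounded_ops UNIV"
    by (simp add: bounded_ops_UNIV_iff bounded_ops_scaleC[OF T] bounded_ops_scaleC[OF cadjoint_bounded_ops])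
  have "bounded ((\<lambda>g. complex_of_real ((norm (T g))\<^sup>2)) ` G)"
    unfolding bounded_iff using norm_T_basis_le
    by (auto simp: norm_power intro!: exI[of _ "(onorm T)\<^sup>2"] power_mono)
  then show "diag (\<lambda>g. complex_of_real ((norm (T g))\<^sup>2)) \<in> bounded_ops UNIV"
    and "\<And>g. g \<in> G \<Longrightarrow> (cadjoint T \<circ> T) g = diag (\<lambda>g. complex_of_real ((norm (T g))\<^sup>2)) g"
    by (simp_all add: diag_bounded_ops diag_basis gram_eigen)
qed

text \<open>Uniqueness of the positive square root is checked on the basis. If \<open>Q\<close> is
  another root, then \<open>v = Q g - modulus g *\<^sub>C g\<close> satisfies
  \<open>Q v = - (modulus g *\<^sub>C v)\<close>, so positivity forces \<open>v = 0\<close> when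
  \<open>T g \<noteq> 0\<close>. When \<open>T g = 0\<close>, self-adjointness gives
  \<open>Q g = 0\<close>.\<close>

lemma abs_op_eq_diag: "abs_op T = diag modulus"
  unfolding abs_op_def
proof (rule the_equality)
  show "positive_op (diag modulus) \<and> diag modulus \<circ> diag modulus = cadjoint T \<circ> T"
    by (auto simp: positive_op_diag_modulus cadjoint_T_comp fun_eq_iff
        diag_diag[OF bounded_modulus bounded_modulus] power2_eq_square)
next
  fix Q assume Q: "positive_op Q \<and> Q \<circ> Q = cadjoint T \<circ> T"
  then have Qb: "Q \<in> bounded_ops UNIV" by (simp add: positive_op_def)
  interpret Q: bounded_linear Q by (rule bounded_ops_bounded_linear[OF Qb])
  show "Q = diag modulus"
  proof (rule bounded_op_eqI[OF Qb diag_bounded_ops[OF bounded_modulus]])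
    fix g assume g: "g \<in> G"
    define v where "v = Q g - modulus g *\<^sub>C g"
    have QQ: "Q (Q g) = complex_of_real ((norm (T g))\<^sup>2) *\<^sub>C g"
      using Q gram_eigen[OF g] by (metis comp_apply)
    have "v = 0"
    proof (cases "T g = 0")
      case True
      have "cinner (Q g) (Q g) = cinner (Q (Q g)) g"
        using Q positive_op_self_adjoint by metis
      then show ?thesis using True by (simp add: v_def QQ)
    next
      case False
      have "Q v = - (modulus g *\<^sub>C v)"
        by (simp add: v_def Q.diff QQ bounded_ops_scaleC[OF Qb] scaleC_scaleC
            complex_vector.scale_right_diff_distrib power2_eq_square)
      then have "cinner (Q v) v = - complex_of_real (norm (T g) * (norm v)\<^sup>2)"
        by (simp add: cinner_self)
      moreover have "0 \<le> Re (cinner (Q v) v)" using Q by (simp add: positive_op_def)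
      ultimately have "norm (T g) * (norm v)\<^sup>2 \<le> 0" by simp
      then show ?thesis using False by (simp add: mult_le_0_iff)
    qed
    then show "Q g = diag modulus g"
      by (simp add: v_def diag_basis[OF bounded_modulus g])
  qed
qed

end

section \<open>Minimisers of the norm on a subspace\<close>

lemma min_modulus_le:
  assumes "z \<in> M" "norm z = 1"
  shows "min_modulus M T \<le> norm (T z)"
  unfolding min_modulus_def
  using assms by (intro cInf_lower) (auto intro!: bdd_belowI[of _ 0])

text \<open>First-order condition at a minimum of the Rayleigh quotient over \<open>M\<close>.\<close>

lemma min_modulus_stationary:
  assumes T: "T \<in> bounded_ops UNIV" and M: "closed_csubspace M"
    and x: "x \<in> M" "norm x = 1" "norm (T x) = min_modulus M T" and y: "y \<in> M"
  shows "cinner (T x) (T y) = complex_of_real ((norm (T x))\<^sup>2) * cinner x y"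
proof -
  interpret T: bounded_linear T by (rule bounded_ops_bounded_linear[OF T])
  have sub: "complex_vector.subspace M" using M by (simp add: closed_csubspace_def)
  define \<mu> where "\<mu> = (norm (T x))\<^sup>2"
  have low: "\<mu> * (norm z)\<^sup>2 \<le> (norm (T z))\<^sup>2" if z: "z \<in> M" for z
  proof (cases "z = 0")
    case False
    have "norm (T x) \<le> norm (T ((1 / norm z) *\<^sub>R z))"
      unfolding x(3) scaleR_scaleC
      using complex_vector.subspace_scale[OF sub z] False
      by (intro min_modulus_le) (auto simp: norm_divide)
    then have "norm (T x) * norm z \<le> norm (T z)"
      using False by (simp add: T.scaleR field_simps)
    then have "(norm (T x) * norm z)\<^sup>2 \<le> (norm (T z))\<^sup>2" by (intro power_mono) auto
    then show ?thesis by (simp add: \<mu>_def power_mult_distrib)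
  qed simp
  define w where "w = cinner (T x) (T y) - complex_of_real \<mu> * cinner x y"
  define D where "D = (norm (T y))\<^sup>2 - \<mu> * (norm y)\<^sup>2"
  have "0 \<le> D" using low[OF y] by (simp add: D_def)
  \<comment> \<open>At \<open>x + t *\<^sub>C y\<close>, \<open>low\<close> becomes a quadratic
    inequality in \<open>t\<close> with first-order coefficient \<open>w\<close> and second-order
    coefficient \<open>D\<close>. The descent step \<open>t = - s * w\<close> reduces it to
    \<open>0 \<le> s * (cmod w)\<^sup>2 * (s * D - 2)\<close>; the chosen \<open>s\<close> has
    \<open>s * D < 1\<close>, so \<open>w = 0\<close>.\<close>
  define s where "s = 1 / (D + 1)"
  define t where "t = - complex_of_real s * w"
  have "x + t *\<^sub>C y \<in> M"
    by (intro complex_vector.subspace_add complex_vector.subspace_scale sub x y)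
  from low[OF this] have "0 \<le> 2 * Re (cnj t * w) + (cmod t)\<^sup>2 * D"
    by (simp add: norm_add_power2 T.add bounded_ops_scaleC[OF T] x(2) w_def D_def \<mu>_def[symmetric]
        power_mult_distrib algebra_simps)
  also have "cnj t * w = complex_of_real (- s * (cmod w)\<^sup>2)"
    by (simp add: t_def complex_norm_square mult.assoc mult.commute[of w] del: of_real_power)
  also have "(cmod t)\<^sup>2 = s\<^sup>2 * (cmod w)\<^sup>2"
    by (simp add: t_def norm_mult power_mult_distrib)
  finally have "0 \<le> s * (cmod w)\<^sup>2 * (s * D - 2)"
    by (simp add: algebra_simps power2_eq_square)
  moreover have "s > 0" "s * D - 2 < 0"
    using \<open>0 \<le> D\<close> by (auto simp: s_def field_simps)
  ultimately have "(cmod w)\<^sup>2 \<le> 0"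
    by (metis mult_pos_neg mult_pos_pos not_le)
  then show ?thesis by (simp add: w_def \<mu>_def)
qed

section \<open>Absolutely minimum attaining operators\<close>

lemma ex_eigen_onb:
  fixes T :: "'a::chilbert_space \<Rightarrow> 'a"
  assumes AM: "abs_min_attaining T"
  shows "\<exists>G. eigen_onb G T"
proof -
  have T: "T \<in> bounded_ops UNIV" using AM by (simp add: abs_min_attaining_def)
  interpret T: bounded_linear T by (rule bounded_ops_bounded_linear[OF T])
  define E where
    "E = {x. \<forall>y. cinner (T x) (T y) = complex_of_real ((norm (T x))\<^sup>2) * cinner x y}"
  define \<A> where "\<A> = {G. orthonormal G \<and> G \<subseteq> E}"
  have "\<exists>G\<in>\<A>. \<forall>F\<in>\<A>. G \<subseteq> F \<longrightarrow> F = G"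
  proof (rule subset_Zorn')
    fix C assume C: "subset.chain \<A> C"
    have "orthonormal (\<Union>C)"
      unfolding orthonormal_def
    proof (intro conjI ballI impI)
      fix g h assume "g \<in> \<Union>C" "h \<in> \<Union>C" "g \<noteq> h"
      then obtain X Y where "X \<in> C" "Y \<in> C" "g \<in> X" "h \<in> Y" by blast
      moreover from this have "X \<subseteq> Y \<or> Y \<subseteq> X" using C by (auto simp: subset_chain_def)
      ultimately obtain Z where "Z \<in> C" "g \<in> Z" "h \<in> Z" by blast
      moreover from this have "orthonormal Z" using C by (auto simp: subset_chain_def \<A>_def)
      ultimately show "cinner g h = 0" using \<open>g \<noteq> h\<close> by (simp add: orthonormal_def)
    next
      fix g assume "g \<in> \<Union>C"
      then show "norm g = 1" using C by (auto simp: subset_chain_def \<A>_def orthonormal_def)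
    qed
    then show "\<Union>C \<in> \<A>" using C by (auto simp: \<A>_def subset_chain_def)
  qed
  then obtain G where G: "orthonormal G" "G \<subseteq> E"
    and max: "\<And>F. orthonormal F \<Longrightarrow> F \<subseteq> E \<Longrightarrow> G \<subseteq> F \<Longrightarrow> F = G"
    by (auto simp: \<A>_def)
  define M where "M = orth_complement G"
  have M: "closed_csubspace M"
    unfolding M_def by (rule closed_csubspace_orth_complement)
  have "M = {0}"
  proof (rule ccontr)
    assume "M \<noteq> {0}"
    then have "min_attaining M T" using AM M by (simp add: abs_min_attaining_def)
    then obtain x where x: "x \<in> M" "norm x = 1" "norm (T x) = min_modulus M T"
      by (auto simp: min_attaining_def)
    have "cinner (T x) (T y) = complex_of_real ((norm (T x))\<^sup>2) * cinner x y" for y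
    proof -
      \<comment> \<open>Stationarity covers only test vectors in \<open>M\<close>, so
        \<open>y\<close> is split into its projection \<open>p\<close> onto the closed span of
        \<open>G\<close> and \<open>y - p \<in> M\<close>. The part \<open>p\<close> contributes
        nothing: \<open>T p\<close> is orthogonal to \<open>T x\<close> because \<open>G\<close>
        consists of eigenvectors.\<close>
      obtain p where p: "((\<lambda>g. cinner y g *\<^sub>C g) has_sum p) G"
        "\<And>g. g \<in> G \<Longrightarrow> cinner p g = cinner y g"
        using orthonormal_expansion[OF G(1)] by blast
      have gx: "cinner g x = 0" "cinner (T g) (T x) = 0" if "g \<in> G" for g
        using that x(1) G(2) cinner_eq_0_commute by (force simp: M_def orth_complement_def E_def)+
      have "((\<lambda>g. cinner (cinner y g *\<^sub>C g) x) has_sum cinner p x) G"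
        by (rule has_sum_bounded_linear[OF bounded_linear_cinner_left p(1)])
      then have "((\<lambda>g. 0) has_sum cinner p x) G"
        by (rule has_sum_cong[THEN iffD1, rotated]) (simp add: gx)
      then have px: "cinner p x = 0" by (rule has_sum_unique) simp
      have "((\<lambda>g. cinner (T (cinner y g *\<^sub>C g)) (T x)) has_sum cinner (T p) (T x)) G"
        by (rule has_sum_bounded_linear[OF bounded_linear_cinner_left
              has_sum_bounded_linear[OF T.bounded_linear_axioms p(1)]])
      then have "((\<lambda>g. 0) has_sum cinner (T p) (T x)) G"
        by (rule has_sum_cong[THEN iffD1, rotated]) (simp add: gx bounded_ops_scaleC[OF T])
      then have Tpx: "cinner (T p) (T x) = 0" by (rule has_sum_unique) simp
      have "y - p \<in> M" by (simp add: M_def orth_complement_def cinner_diff_left p(2))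
      from min_modulus_stationary[OF T M x this] show ?thesis
        using px Tpx cinner_eq_0_commute[of p x] cinner_eq_0_commute[of "T p" "T x"]
        by (simp add: T.diff cinner_diff_right)
    qed
    then have "x \<in> E" by (simp add: E_def)
    have "orthonormal (insert x G)"
      using G(1) x cinner_eq_0_commute by (auto simp: orthonormal_def M_def orth_complement_def)
    then have "insert x G = G" using max G(2) \<open>x \<in> E\<close> by blast
    then have "x \<in> G" by blast
    then have "cinner x x = 0" using x(1) unfolding M_def orth_complement_def by blast
    then show False using x(2) by simp
  qed
  then have "eigen_onb G T"
    using G by unfold_locales (auto simp: M_def orth_complement_def E_def T)
  then show ?thesis by blast
qed

locale am_onb = eigen_onb +
  assumes AM: "abs_min_attaining T"
begin

text \<open>The minimum of \<open>T\<close> over the closed span of the \<open>f k\<close> cannot be attained: a minimiser would have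
  to be orthogonal to every \<open>f k\<close>. The closed span is written as a double orthogonal complement.\<close>

lemma no_decreasing_orthogonal_sequence:
  fixes f :: "nat \<Rightarrow> 'a"
  assumes norm: "\<And>k. norm (f k) = 1"
    and orth: "\<And>j k. j \<noteq> k \<Longrightarrow> cinner (f j) (f k) = 0" "\<And>j k. j \<noteq> k \<Longrightarrow> cinner (T (f j)) (T (f k)) = 0"
    and dec: "\<And>k. norm (T (f (Suc k))) < norm (T (f k))"
  shows False
proof -
  define Z where "Z = orth_complement (range f)"
  define M where "M = orth_complement Z"
  have M: "closed_csubspace M"
    unfolding M_def by (rule closed_csubspace_orth_complement)
  have fM: "f k \<in> M" for k
    using cinner_eq_0_commute by (auto simp: M_def Z_def orth_complement_def)
  moreover have "f 0 \<noteq> 0" using norm[of 0] by auto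
  ultimately have "M \<noteq> {0}" by blast
  then have "min_attaining M T" using AM M by (simp add: abs_min_attaining_def)
  then obtain x where x: "x \<in> M" "norm x = 1" "norm (T x) = min_modulus M T"
    by (auto simp: min_attaining_def)
  have "cinner x (f k) = 0" for k
  proof -
    \<comment> \<open>This \<open>z\<close> is orthogonal to every \<open>f j\<close>, hence to
      \<open>x\<close>. So \<open>f k\<close> acts as an eigenvector of the compression of
      \<open>T\<^sup>* T\<close> to \<open>M\<close>, as does \<open>x\<close> by stationarity; the
      two eigenvalues differ, whence \<open>x\<close> is orthogonal to \<open>f k\<close>.\<close>
    define z where "z = cadjoint T (T (f k)) - complex_of_real ((norm (T (f k)))\<^sup>2) *\<^sub>C f k"
    have "cinner z (f j) = 0" for j
      using orth norm by (cases "j = k") (auto simp: z_def cinner_diff_left adjoint' cinner_self)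
    then have "cinner x z = 0" using x(1) by (simp add: M_def Z_def orth_complement_def)
    then have "cinner (T x) (T (f k)) = complex_of_real ((norm (T (f k)))\<^sup>2) * cinner x (f k)"
      by (simp add: z_def cinner_diff_right adjoint)
    moreover have "cinner (T x) (T (f k)) = complex_of_real ((norm (T x))\<^sup>2) * cinner x (f k)"
      by (rule min_modulus_stationary[OF T M x fM])
    moreover have "norm (T x) < norm (T (f k))"
      using min_modulus_le[OF fM norm, of T "Suc k"] dec[of k] x(3) by simp
    then have "(norm (T x))\<^sup>2 < (norm (T (f k)))\<^sup>2" by (intro power_strict_mono) auto
    ultimately show ?thesis by (metis less_irrefl mult_cancel_right of_real_eq_iff)
  qed
  then have "x \<in> Z" by (simp add: Z_def orth_complement_def)
  then have "cinner x x = 0" using x(1) by (simp add: M_def orth_complement_def)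
  then show False using x(2) by simp
qed

text \<open>Basis vectors of the two kinds are combined in pairs to unit vectors \<open>f k\<close> for which
  \<open>(norm (T (f k)))\<^sup>2\<close> takes prescribed, strictly decreasing values between \<open>a\<^sup>2\<close> and \<open>b\<^sup>2\<close>.\<close>

lemma not_infinite_below_above:
  assumes "0 \<le> a" "a < b"
    and "infinite {g \<in> G. norm (T g) \<le> a}" "infinite {g \<in> G. b \<le> norm (T g)}"
  shows False
proof -
  obtain g :: "nat \<Rightarrow> 'a" where g: "inj g" "\<And>k. g k \<in> G" "\<And>k. norm (T (g k)) \<le> a"
    using infinite_countable_subset[OF assms(3)] by auto
  obtain h :: "nat \<Rightarrow> 'a" where h: "inj h" "\<And>k. h k \<in> G" "\<And>k. b \<le> norm (T (h k))"
    using infinite_countable_subset[OF assms(4)] by auto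
  define D where "D = b\<^sup>2 - a\<^sup>2"
  have "0 < D" using assms(1,2) by (simp add: D_def power_strict_mono)
  \<comment> \<open>The offset 2 keeps already \<open>c 0\<close> strictly below
    \<open>b\<^sup>2\<close>.\<close>
  define c where "c k = a\<^sup>2 + D / real (k + 2)" for k
  have c: "a\<^sup>2 < c k" "c k < b\<^sup>2" "c (Suc k) < c k" for k
  proof -
    have "D / real (Suc k + 2) < D / real (k + 2)"
      using \<open>0 < D\<close> by (intro divide_strict_left_mono) auto
    moreover have "D / real (k + 2) < D" "0 < D / real (k + 2)"
      using \<open>0 < D\<close> by (auto simp: divide_less_eq)
    ultimately show "a\<^sup>2 < c k" "c k < b\<^sup>2" "c (Suc k) < c k" by (auto simp: c_def D_def)
  qed
  define p q where "p k = (norm (T (g k)))\<^sup>2" and "q k = (norm (T (h k)))\<^sup>2" for k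
  have pq: "p k \<le> a\<^sup>2" "b\<^sup>2 \<le> q k" for k
    unfolding p_def q_def using g(3) h(3) assms(1,2) by (auto intro!: power_mono)
  \<comment> \<open>The weight that writes \<open>c k\<close> as a convex combination of
    \<open>p k\<close> and \<open>q k\<close>. Square roots of the weights enter \<open>f k\<close>
    because squared norms add along orthogonal vectors.\<close>
  define t where "t k = (c k - p k) / (q k - p k)" for k
  have t: "0 \<le> t k" "t k \<le> 1" "(1 - t k) * p k + t k * q k = c k" for k
  proof -
    have *: "p k < c k" "c k < q k" using c[of k] pq[of k] by auto
    then show "0 \<le> t k" "t k \<le> 1" by (auto simp: t_def)
    have "t k * (q k - p k) = c k - p k" using * by (simp add: t_def)
    then show "(1 - t k) * p k + t k * q k = c k" by (simp add: algebra_simps)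
  qed
  define f where "f k = sqrt (1 - t k) *\<^sub>R g k + sqrt (t k) *\<^sub>R h k" for k
  have gh: "g j \<noteq> h k" for j k
    using g(3)[of j] h(3)[of k] assms(2) by (metis leD le_less_trans)
  have Tf: "T (f k) = sqrt (1 - t k) *\<^sub>R T (g k) + sqrt (t k) *\<^sub>R T (h k)" for k
    by (simp add: f_def T.add T.scaleR)
  have orth: "cinner (g j) (h k) = 0" "cinner (h k) (g j) = 0"
    "cinner (T (g j)) (T (h k)) = 0" "cinner (T (h k)) (T (g j)) = 0" for j k
    using gh[of j k] gh[of j k, symmetric] g(2) h(2) by (auto simp: cinner_basis eigen)
  have orth': "cinner (g j) (g k) = 0" "cinner (h j) (h k) = 0"
    "cinner (T (g j)) (T (g k)) = 0" "cinner (T (h j)) (T (h k)) = 0" if "j \<noteq> k" for j k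
    using that g h by (auto simp: cinner_basis eigen inj_eq)
  have norm_Tf: "(norm (T (f k)))\<^sup>2 = c k" for k
    using t[of k]
    by (simp add: Tf norm_add_power2 orth power_mult_distrib p_def q_def)
  show False
  proof (rule no_decreasing_orthogonal_sequence[of f])
    fix k
    have "(norm (f k))\<^sup>2 = 1"
      using t[of k] by (simp add: f_def norm_add_power2 orth power_mult_distrib norm_basis g h)
    then show "norm (f k) = 1"
      using power2_eq_iff_nonneg[of "norm (f k)" 1] by simp
    have "(norm (T (f (Suc k))))\<^sup>2 < (norm (T (f k)))\<^sup>2"
      unfolding norm_Tf by (rule c(3))
    then show "norm (T (f (Suc k))) < norm (T (f k))"
      by (rule power2_less_imp_less) simp
  next
    fix j k :: nat assume "j \<noteq> k"
    then show "cinner (f j) (f k) = 0"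
      by (simp add: f_def cinner_add_left cinner_add_right orth orth')
    show "cinner (T (f j)) (T (f k)) = 0"
      unfolding Tf using \<open>j \<noteq> k\<close> by (simp add: cinner_add_left cinner_add_right orth orth')
  qed
qed

text \<open>Take \<alpha> to be the infimum of the bounds \<open>a\<close> with infinitely many
  entries at most \<open>a\<close>. The mixing argument leaves only finitely many entries above each
  \<open>b > \<alpha>\<close>, so infinitely many entries above \<alpha> would contain a strictly
  decreasing sequence, which is impossible.\<close>

lemma ex_essential_value:
  assumes "infinite G"
  obtains \<alpha> where "0 \<le> \<alpha>" "finite {g \<in> G. \<alpha> < norm (T g)}"
    "\<And>b. b < \<alpha> \<Longrightarrow> finite {g \<in> G. norm (T g) \<le> b}"
proof -
  define L where "L = {a. infinite {g \<in> G. norm (T g) \<le> a}}"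
  have "{g \<in> G. norm (T g) \<le> onorm T} = G" using norm_T_basis_le by auto
  then have ne: "L \<noteq> {}" using assms by (auto simp: L_def intro!: exI[of _ "onorm T"])
  have nonneg: "0 \<le> a" if "a \<in> L" for a
  proof (rule ccontr)
    assume "\<not> 0 \<le> a"
    then have "{g \<in> G. norm (T g) \<le> a} = {}" by (auto simp: not_le intro: less_le_trans)
    then show False using that unfolding L_def by (metis finite.emptyI mem_Collect_eq)
  qed
  then have bdd: "bdd_below L" by (meson bdd_belowI)
  define \<alpha> where "\<alpha> = Inf L"
  have above: "finite {g \<in> G. b \<le> norm (T g)}" if b: "\<alpha> < b" for b
  proof -
    obtain a where "a \<in> L" "a < b"
      using b cInf_lessD[OF ne] by (auto simp: \<alpha>_def)
    then show ?thesis
      using nonneg not_infinite_below_above[of a b] by (auto simp: L_def)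
  qed
  show thesis
  proof (rule that)
    show "0 \<le> \<alpha>" unfolding \<alpha>_def using nonneg by (intro cInf_greatest ne)
    show "finite {g \<in> G. norm (T g) \<le> b}" if "b < \<alpha>" for b
      using cInf_lower[OF _ bdd, of b] that by (auto simp: L_def \<alpha>_def)
    show "finite {g \<in> G. \<alpha> < norm (T g)}"
    proof (rule ccontr)
      assume inf: "infinite {g \<in> G. \<alpha> < norm (T g)}"
      have "\<exists>f. \<forall>k. (f k \<in> G \<and> \<alpha> < norm (T (f k))) \<and> norm (T (f (Suc k))) < norm (T (f k))"
      proof (rule dependent_nat_choice)
        show "\<exists>g. g \<in> G \<and> \<alpha> < norm (T g)"
          using inf by (metis (mono_tags, lifting) Collect_empty_eq finite.emptyI)
      next
        fix g and k :: nat assume "g \<in> G \<and> \<alpha> < norm (T g)"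
        \<comment> \<open>By \<open>above\<close>, only finitely many entries are at least
          \<open>norm (T g)\<close>; discarding them leaves a smaller entry still above
          \<alpha>.\<close>
        then have "infinite ({h \<in> G. \<alpha> < norm (T h)} - {h \<in> G. norm (T g) \<le> norm (T h)})"
          using inf above by simp
        then obtain h where "h \<in> {h \<in> G. \<alpha> < norm (T h)} - {h \<in> G. norm (T g) \<le> norm (T h)}"
          by (metis finite.emptyI ex_in_conv)
        then show "\<exists>h. (h \<in> G \<and> \<alpha> < norm (T h)) \<and> norm (T h) < norm (T g)" by auto
      qed
      then obtain f where f: "\<And>k. f k \<in> G" and dec: "\<And>k. norm (T (f (Suc k))) < norm (T (f k))"
        by blast
      have "strict_mono (\<lambda>k. - norm (T (f k)))"
        using dec by (simp add: strict_mono_Suc_iff)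
      then have "f j \<noteq> f k" if "j \<noteq> k" for j k
        using that by (auto dest: strict_mono_eq[of _ j k])
      then show False
        using no_decreasing_orthogonal_sequence[of f] f dec
        by (simp add: norm_basis cinner_basis eigen)
    qed
  qed
qed

end

text \<open>Supplies the indexing of the \<beta> family by a finite or infinite initial segment
  starting at 1; \<open>from_nat_into\<close> counts from 0, hence the shift in the infinite
  case.\<close>

lemma countable_enumeration:
  assumes "countable X"
  shows "\<exists>m \<beta>. bij_betw \<beta> {j. 1 \<le> j \<and> enat j \<le> m} X"
proof (cases "finite X")
  case True
  then obtain \<beta> where "bij_betw \<beta> {1..card X} X"
    using ex_bij_betw_nat_finite_1 by blast
  moreover have "{1..card X} = {j. 1 \<le> j \<and> enat j \<le> enat (card X)}" by auto
  ultimately show ?thesis by metis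
next
  case False
  have "bij_betw (\<lambda>j. j - 1) {1..} (UNIV :: nat set)"
    by (rule bij_betwI[where g = Suc]) auto
  then have "bij_betw (from_nat_into X \<circ> (\<lambda>j. j - 1)) {1..} X"
    using bij_betw_from_nat_into[OF assms False] by (rule bij_betw_trans)
  moreover have "{1..} = {j. 1 \<le> j \<and> enat j \<le> \<infinity>}" by auto
  ultimately show ?thesis by metis
qed

section \<open>Quasinormal operators and their level spaces\<close>

text \<open>A unit vector orthogonal to the range of an isometry would generate, under its powers, an
  infinite orthonormal sequence.\<close>

lemma unitary_on_finite_dim:
  assumes M: "complex_vector.subspace M" "cfinite_dim M"
    and U: "U \<in> bounded_ops M" and W: "is_adjoint M U W" and WU: "\<And>x. x \<in> M \<Longrightarrow> W (U x) = x"
  shows "unitary_on M U"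
proof -
  have UM: "U x \<in> M" "W x \<in> M" if "x \<in> M" for x
    using that U W by (auto simp: bounded_ops_def is_adjoint_def)
  have adj: "cinner (U x) y = cinner x (W y)" if "x \<in> M" "y \<in> M" for x y
    using that W by (simp add: is_adjoint_def)
  have "U (W y) = y" if y: "y \<in> M" for y
  proof (rule ccontr)
    assume "U (W y) \<noteq> y"
    define e where "e = y - U (W y)"
    have e: "e \<noteq> 0" "e \<in> M"
      using \<open>U (W y) \<noteq> y\<close> complex_vector.subspace_diff[OF M(1)] y UM by (auto simp: e_def)
    have "cinner (U x) e = 0" if x: "x \<in> M" for x
    proof -
      have "cinner (U x) (U (W y)) = cinner x (W y)"
        by (simp add: adj x y UM WU)
      then show ?thesis by (simp add: e_def cinner_diff_right adj x y)
    qed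
    note Ue = this
    define u where "u = (1 / norm e) *\<^sub>R e"
    have u: "u \<in> M" "norm u = 1"
      using e complex_vector.subspace_scale[OF M(1) e(2), of "complex_of_real (1 / norm e)"]
      by (simp_all add: u_def scaleC_of_real del: of_real_divide)
    define f where "f k = (U ^^ k) u" for k
    have fM: "f k \<in> M" for k
      by (induction k) (auto simp: f_def u UM)
    have f_norm: "norm (f k) = 1" for k
    proof (induction k)
      case (Suc k)
      have "cinner (U (f k)) (U (f k)) = cinner (f k) (f k)"
        by (simp add: adj fM UM WU)
      then have "norm (U (f k)) = norm (f k)"
        by (simp only: cinner_self of_real_eq_iff power2_eq_iff_nonneg norm_ge_zero)
      then show ?case using Suc by (simp add: f_def)
    qed (simp add: f_def u)
    \<comment> \<open>\<open>U\<close> preserves inner products, so lowering both exponents reduces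
      the claim to the orthogonality of the range of \<open>U\<close> to \<open>u\<close>.\<close>
    have f_orth: "cinner (f (Suc (j + k))) (f k) = 0" for j k
    proof (induction k)
      case 0
      have "cinner (U (f j)) e = 0" by (rule Ue[OF fM])
      then show ?case by (simp add: f_def u_def)
    next
      case (Suc k)
      have "cinner (U (f (Suc (j + k)))) (U (f k)) = cinner (f (Suc (j + k))) (f k)"
        by (simp add: adj fM UM WU)
      then show ?case using Suc by (simp add: f_def)
    qed
    have orth: "cinner (f j) (f k) = 0" if "j \<noteq> k" for j k
    proof (cases "k < j")
      case True
      then show ?thesis using f_orth[of "j - Suc k" k] by simp
    next
      case False
      then show ?thesis
        using f_orth[of "k - Suc j" j] that cinner_eq_0_commute[of "f j"] by simp
    qed
    then have "inj f"
      using f_norm by (intro injI) (metis cinner_self_eq_0 norm_zero zero_neq_one)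
    moreover have "finite (range f)"
    proof (rule cfinite_dim_orthonormal[OF M(2)])
      show "orthonormal (range f)" by (auto simp: orthonormal_def f_norm intro!: orth)
    qed (use fM in auto)
    ultimately show False using finite_imageD[of f UNIV] by simp
  qed
  then show ?thesis using U W WU by (auto simp: unitary_on_def)
qed

lemma bounded_ops_mono:
  assumes "A \<in> bounded_ops UNIV" "\<And>x. x \<in> M \<Longrightarrow> A x \<in> M"
  shows "A \<in> bounded_ops M"
  using assms by (auto simp: bounded_ops_def)

lemma bounded_ops_scaleR:
  assumes M: "complex_vector.subspace M" and "A \<in> bounded_ops M"
  shows "(\<lambda>x. r *\<^sub>R A x) \<in> bounded_ops M"
proof -
  obtain K where K: "\<And>x. x \<in> M \<Longrightarrow> norm (A x) \<le> K * norm x"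
    using assms(2) unfolding bounded_ops_def by blast
  have "norm (r *\<^sub>R A x) \<le> (\<bar>r\<bar> * K) * norm x" if "x \<in> M" for x
    using K[OF that] by (simp add: mult.assoc mult_left_mono)
  then have "\<exists>K. \<forall>x\<in>M. norm (r *\<^sub>R A x) \<le> K * norm x" by blast
  then show ?thesis
    using assms(2) complex_vector.subspace_scale[OF M, of _ "complex_of_real r"]
    by (simp add: bounded_ops_def scaleC_of_real scaleR_right_distrib)
      (simp add: scaleR_scaleC scaleC_scaleC mult.commute)
qed

locale quasinormal_onb = eigen_onb +
  assumes qn: "quasinormal T"
begin

text \<open>Since \<open>T\<close> commutes with \<open>T\<^sup>* T\<close>, the vector
  \<open>T h\<close> satisfies the eigenvalue equation of \<open>h\<close>, and vectors for
  different eigenvalues of the self-adjoint \<open>T\<^sup>* T\<close> are orthogonal.\<close>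

lemma cinner_T_different_levels:
  assumes "g \<in> G" "h \<in> G" "norm (T g) \<noteq> norm (T h)"
  shows "cinner (T h) g = 0"
proof -
  have "T (cadjoint T (T h)) = cadjoint T (T (T h))"
    using qn by (simp add: quasinormal_def fun_eq_iff)
  then have "complex_of_real ((norm (T h))\<^sup>2) *\<^sub>C T h = cadjoint T (T (T h))"
    by (simp only: gram_eigen[OF assms(2)] bounded_ops_scaleC[OF T])
  then have "complex_of_real ((norm (T h))\<^sup>2) * cinner (T h) g = cinner (T (T h)) (T g)"
    by (metis adjoint' cinner_scaleC_left)
  also have "\<dots> = cnj (complex_of_real ((norm (T g))\<^sup>2) * cinner g (T h))"
    by (metis cinner_commute eigen[OF assms(1)])
  also have "\<dots> = complex_of_real ((norm (T g))\<^sup>2) * cinner (T h) g"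
    by (simp add: cinner_commute[of g])
  finally show ?thesis
    using assms(3) by (simp only: mult_cancel_right of_real_eq_iff power2_eq_iff_nonneg norm_ge_zero)
      simp
qed

text \<open>The spectral subspace of \<open>|T|\<close> for the set \<open>X\<close>, because
  \<open>|T|\<close> is diagonal with entries \<open>norm (T g)\<close>.\<close>

definition levels :: "real set \<Rightarrow> 'a set" where
  "levels X = supported {g. norm (T g) \<in> X}"

lemma subspace_levels: "complex_vector.subspace (levels X)"
  using closed_csubspace_supported by (simp add: levels_def closed_csubspace_def)

lemma T_levels:
  assumes "x \<in> levels X"
  shows "T x \<in> levels X"
  unfolding levels_def supported_def
proof (intro CollectI ballI)
  fix g assume g: "g \<in> G - {g. norm (T g) \<in> X}"
  have "cinner x h * cinner (T h) g = 0" if "h \<in> G" for h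
  proof (cases "norm (T h) \<in> X")
    case True
    then have "norm (T g) \<noteq> norm (T h)" using g by auto
    then show ?thesis using g that by (simp add: cinner_T_different_levels)
  next
    case False
    then show ?thesis using that assms by (simp add: levels_def supported_def)
  qed
  then have "((\<lambda>h. 0) has_sum cinner (T x) g) G"
    by (intro has_sum_cong[THEN iffD1, OF _ cinner_image_has_sum[OF T]])
  then show "cinner (T x) g = 0" by (rule has_sum_unique) simp
qed

text \<open>Invariance under the adjoint follows from invariance of the orthogonal complement under
  \<open>T\<close>, and that complement is the level space of \<open>- X\<close>.\<close>

lemma cadjoint_levels:
  assumes "x \<in> levels X"
  shows "cadjoint T x \<in> levels X"
  unfolding levels_def supported_def
proof (intro CollectI ballI)
  fix g assume g: "g \<in> G - {g. norm (T g) \<in> X}"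
  then have "g \<in> levels (- X)" by (auto simp: levels_def intro: basis_supported)
  then have "T g \<in> levels (- X)" by (rule T_levels)
  with assms have "cinner x (T g) = 0"
    unfolding levels_def by (rule supported_orthogonal) auto
  then show "cinner (cadjoint T x) g = 0" by (simp add: adjoint')
qed

lemma reducing_levels: "reducing T (levels X)"
proof -
  have "orth_complement (levels X) = levels (- X)"
    unfolding levels_def orth_complement_supported by (auto simp: supported_def)
  then show ?thesis
    using T_levels closed_csubspace_supported by (auto simp: reducing_def) (simp add: levels_def)
qed

lemma null_space_abs_op:
  "null_space (minus_scalar (abs_op T) (complex_of_real c)) = levels {c}"
proof -
  have "bounded ((\<lambda>g. modulus g - complex_of_real c) ` G)"
    using bounded_translation_minus[OF bounded_modulus] by (simp add: image_image)
  then show ?thesis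
    by (simp add: abs_op_eq_diag minus_scalar_diag[OF bounded_modulus] null_space_diag levels_def)
qed

lemma gram_level:
  assumes "x \<in> levels {c}"
  shows "cadjoint T (T x) = complex_of_real (c\<^sup>2) *\<^sub>C x"
proof (rule eqI)
  fix g assume g: "g \<in> G"
  have "cinner (cadjoint T (T x)) g = cnj (cinner (T g) (T x))"
    by (metis adjoint' cinner_commute)
  also have "\<dots> = complex_of_real ((norm (T g))\<^sup>2) * cinner x g"
    by (simp add: eigen[OF g] cinner_commute[of x g])
  also have "\<dots> = complex_of_real (c\<^sup>2) * cinner x g"
    using assms g by (cases "norm (T g) = c") (auto simp: levels_def supported_def)
  finally show "cinner (cadjoint T (T x)) g = cinner (complex_of_real (c\<^sup>2) *\<^sub>C x) g" by simp
qed

lemma norm_T_level: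
  assumes "x \<in> levels {c}" "0 \<le> c"
  shows "norm (T x) = c * norm x"
proof -
  have "complex_of_real ((norm (T x))\<^sup>2) = complex_of_real ((c * norm x)\<^sup>2)"
    unfolding cinner_self[symmetric] adjoint
    by (simp add: gram_level[OF assms(1)] cinner_self power_mult_distrib)
  then show ?thesis
    using assms(2) by (simp only: of_real_eq_iff) (simp add: power2_eq_iff_nonneg)
qed

text \<open>The unitary or isometric factor of \<open>T\<close> on the level space of \<open>c\<close>. On the level space of \<open>0\<close> the
  operator \<open>T\<close> vanishes and any isometry would do.\<close>

definition phase :: "real \<Rightarrow> 'a \<Rightarrow> 'a" where
  "phase c x = (if c = 0 then x else (1 / c) *\<^sub>R T x)"

lemma scaleR_phase:
  assumes "x \<in> levels {c}" "0 \<le> c"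
  shows "c *\<^sub>R phase c x = T x"
  using norm_T_level[OF assms] by (auto simp: phase_def)

lemma phase_bounded_ops: "phase c \<in> bounded_ops (levels {c})"
proof (cases "c = 0")
  case True
  then show ?thesis by (auto simp: phase_def bounded_ops_def intro!: exI[of _ 1])
next
  case False
  have "(\<lambda>x. (1 / c) *\<^sub>R T x) \<in> bounded_ops (levels {c})"
    by (rule bounded_ops_scaleR[OF subspace_levels bounded_ops_mono[OF T T_levels]])
  then show ?thesis using False by (simp add: phase_def[abs_def])
qed

lemma isometry_on_phase: "0 \<le> c \<Longrightarrow> isometry_on (levels {c}) (phase c)"
  by (simp add: isometry_on_def phase_bounded_ops) (simp add: phase_def norm_T_level[of _ c])

text \<open>The scaled adjoint \<open>W\<close> is a left inverse by \<open>gram_level\<close>;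
  finite dimension of the level space makes it a two-sided inverse.\<close>

lemma unitary_on_phase:
  assumes "finite {g \<in> G. norm (T g) = c}"
  shows "unitary_on (levels {c}) (phase c)"
proof -
  define W where "W x = (if c = 0 then x else (1 / c) *\<^sub>R cadjoint T x)" for x
  have "W \<in> bounded_ops (levels {c})"
  proof (cases "c = 0")
    case True
    then show ?thesis by (auto simp: W_def bounded_ops_def intro!: exI[of _ 1])
  next
    case False
    have "(\<lambda>x. (1 / c) *\<^sub>R cadjoint T x) \<in> bounded_ops (levels {c})"
      by (rule bounded_ops_scaleR[OF subspace_levels
            bounded_ops_mono[OF cadjoint_bounded_ops cadjoint_levels]])
    then show ?thesis using False by (simp add: W_def[abs_def])
  qed
  then have adj: "is_adjoint (levels {c}) (phase c) W"
    by (simp add: is_adjoint_def phase_def W_def adjoint)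
  have "W (phase c x) = x" if "x \<in> levels {c}" for x
    using gram_level[OF that] bounded_linear.linear[OF bounded_ops_bounded_linear[OF cadjoint_bounded_ops]]
    by (simp add: W_def phase_def linear_cmul scaleC_of_real power2_eq_square)
      (simp flip: of_real_mult add: scaleC_of_real)
  moreover have "cfinite_dim (levels {c})"
    unfolding levels_def using assms by (intro cfinite_dim_supported) (simp add: Int_def)
  ultimately show ?thesis
    by (intro unitary_on_finite_dim[OF subspace_levels _ phase_bounded_ops adj])
qed

lemma is_orth_sum_levels:
  assumes "\<And>g. g \<in> G \<Longrightarrow> norm (T g) \<in> X \<longleftrightarrow> norm (T g) \<in> (\<Union>i\<in>I. Y i)"
    and "\<And>i j. i \<in> I \<Longrightarrow> j \<in> I \<Longrightarrow> i \<noteq> j \<Longrightarrow> Y i \<inter> Y j = {}"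
  shows "is_orth_sum (levels X) I (\<lambda>i. levels (Y i))"
  unfolding levels_def
proof (rule is_orth_sum_supported)
  show "G \<inter> {g. norm (T g) \<in> X} = (\<Union>i\<in>I. G \<inter> {g. norm (T g) \<in> Y i})"
    using assms(1) by auto
  show "{g. norm (T g) \<in> Y i} \<inter> {g. norm (T g) \<in> Y j} = {}" if "i \<in> I" "j \<in> I" "i \<noteq> j" for i j
    using assms(2)[OF that] by auto
qed

text \<open>The values \<open>c i\<close> must cover all entries but need not occur as entries: the
  level space of a value that does not occur is \<open>{0}\<close>. This accommodates the case that
  \<alpha> is not an eigenvalue of \<open>|T|\<close>.\<close>

lemma is_op_sum_levels:
  assumes "inj_on c I" "\<And>g. g \<in> G \<Longrightarrow> norm (T g) \<in> c ` I" "\<And>i. i \<in> I \<Longrightarrow> 0 \<le> c i"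
  shows "is_op_sum UNIV I (\<lambda>i. levels {c i}) (\<lambda>i x. c i *\<^sub>R phase (c i) x) T"
  unfolding is_op_sum_def
proof (intro conjI allI impI ballI)
  have "is_orth_sum (levels UNIV) I (\<lambda>i. levels {c i})"
  proof (rule is_orth_sum_levels)
    show "norm (T g) \<in> UNIV \<longleftrightarrow> norm (T g) \<in> (\<Union>i\<in>I. {c i})" if "g \<in> G" for g
      using assms(2)[OF that] by blast
    show "{c i} \<inter> {c j} = {}" if "i \<in> I" "j \<in> I" "i \<noteq> j" for i j
      using inj_onD[OF assms(1)] that by blast
  qed
  then show "is_orth_sum UNIV I (\<lambda>i. levels {c i})"
    by (simp add: levels_def supported_UNIV)
  show "(\<lambda>x. c i *\<^sub>R phase (c i) x) \<in> bounded_ops (levels {c i})" for i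
    by (rule bounded_ops_scaleR[OF subspace_levels phase_bounded_ops])
next
  fix x y assume x: "(\<forall>i\<in>I. x i \<in> levels {c i}) \<and> (x has_sum y) I"
  then have "((\<lambda>i. T (x i)) has_sum T y) I"
    by (intro has_sum_bounded_linear[OF T.bounded_linear_axioms]) simp
  then show "((\<lambda>i. c i *\<^sub>R phase (c i) (x i)) has_sum T y) I"
    using x assms(3) has_sum_cong[of I "\<lambda>i. c i *\<^sub>R phase (c i) (x i)" "\<lambda>i. T (x i)"]
    by (simp add: scaleR_phase)
qed

end

section \<open>The essential spectrum of the absolute value\<close>

locale essential_value = eigen_onb +
  fixes \<alpha> :: real
  assumes inf_G: "infinite G"
    and fin_above: "finite {g \<in> G. \<alpha> < norm (T g)}"
    and fin_below: "\<And>b. b < \<alpha> \<Longrightarrow> finite {g \<in> G. norm (T g) \<le> b}"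
begin

text \<open>The entries can accumulate only at \<alpha>.\<close>

lemma finite_away:
  assumes "0 < r"
  shows "finite {g \<in> G. r \<le> cmod (modulus g - complex_of_real \<alpha>)}"
proof (rule finite_subset)
  show "{g \<in> G. r \<le> cmod (modulus g - complex_of_real \<alpha>)}
      \<subseteq> {g \<in> G. \<alpha> < norm (T g)} \<union> {g \<in> G. norm (T g) \<le> \<alpha> - r}"
    using assms by (auto simp: norm_of_real simp flip: of_real_diff)
  show "finite ({g \<in> G. \<alpha> < norm (T g)} \<union> {g \<in> G. norm (T g) \<le> \<alpha> - r})"
    using assms fin_above fin_below by simp
qed

lemma finite_near:
  assumes "z \<noteq> complex_of_real \<alpha>"
  shows "finite {g \<in> G. cmod (modulus g - z) < cmod (z - complex_of_real \<alpha>) / 2}"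
proof (rule finite_subset)
  show "{g \<in> G. cmod (modulus g - z) < cmod (z - complex_of_real \<alpha>) / 2}
      \<subseteq> {g \<in> G. cmod (z - complex_of_real \<alpha>) / 2 \<le> cmod (modulus g - complex_of_real \<alpha>)}"
  proof safe
    fix g assume "cmod (modulus g - z) < cmod (z - complex_of_real \<alpha>) / 2"
    moreover have "cmod (z - complex_of_real \<alpha>)
        \<le> cmod (modulus g - z) + cmod (modulus g - complex_of_real \<alpha>)"
      using norm_triangle_ineq[of "z - modulus g" "modulus g - complex_of_real \<alpha>"]
      by (simp add: norm_minus_commute)
    ultimately show "cmod (z - complex_of_real \<alpha>) / 2 \<le> cmod (modulus g - complex_of_real \<alpha>)"
      by linarith
  qed
qed (rule finite_away, use assms in simp)

lemma finite_level:
  assumes "z \<noteq> complex_of_real \<alpha>"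
  shows "finite {g \<in> G. modulus g = z}"
  by (rule finite_subset[OF _ finite_near[OF assms]]) (use assms in auto)

text \<open>Only finitely many entries lie within \<open>r\<close> of \<open>z\<close>, so the
  nonzero distances among them have a positive minimum. Inserting \<open>r\<close> keeps the finite
  set nonempty and accounts for all remaining entries.\<close>

lemma gap:
  assumes "z \<noteq> complex_of_real \<alpha>"
  obtains \<delta> where "0 < \<delta>" "\<And>g. g \<in> G \<Longrightarrow> modulus g - z \<noteq> 0 \<Longrightarrow> \<delta> \<le> cmod (modulus g - z)"
proof -
  define r where "r = cmod (z - complex_of_real \<alpha>) / 2"
  define F where "F = insert r ((\<lambda>g. cmod (modulus g - z)) ` {g \<in> G. cmod (modulus g - z) < r \<and> modulus g \<noteq> z})"
  have "finite {g \<in> G. cmod (modulus g - z) < r \<and> modulus g \<noteq> z}"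
    using finite_near[OF assms] by (rule rev_finite_subset) (auto simp: r_def)
  then have F: "finite F" "F \<noteq> {}" by (simp_all add: F_def)
  show thesis
  proof (rule that)
    show "0 < Min F" using assms F by (simp add: Min_gr_iff) (auto simp: F_def r_def)
    show "Min F \<le> cmod (modulus g - z)" if "g \<in> G" "modulus g - z \<noteq> 0" for g
    proof (cases "cmod (modulus g - z) < r")
      case True
      then show ?thesis using that F by (intro Min_le) (auto simp: F_def)
    next
      case False
      moreover have "Min F \<le> r" using F by (intro Min_le) (auto simp: F_def)
      ultimately show ?thesis by linarith
    qed
  qed
qed

text \<open>The value \<alpha> is set apart because it may be a limit of entries without being one;
  both spectral intervals in the theorem exclude it.\<close>

lemma spectrum_abs_op:
  assumes "z \<noteq> complex_of_real \<alpha>"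
  shows "z \<in> spectrum (abs_op T) \<longleftrightarrow> z \<in> modulus ` G"
proof
  assume z: "z \<in> spectrum (abs_op T)"
  obtain \<delta> where \<delta>: "0 < \<delta>" "\<And>g. g \<in> G \<Longrightarrow> modulus g - z \<noteq> 0 \<Longrightarrow> \<delta> \<le> cmod (modulus g - z)"
    using gap[OF assms] by blast
  show "z \<in> modulus ` G"
  proof (rule ccontr)
    assume "z \<notin> modulus ` G"
    then have "\<delta> \<le> cmod (modulus g - z)" if "g \<in> G" for g
      using \<delta>(2) that by auto
    then show False
      using z notin_spectrum_diag[OF bounded_modulus \<delta>(1)] by (simp add: abs_op_eq_diag)
  qed
next
  assume "z \<in> modulus ` G"
  then show "z \<in> spectrum (abs_op T)"
    unfolding abs_op_eq_diag using in_spectrum_diag[OF bounded_modulus] by blast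
qed

text \<open>Away from \<alpha> the gap and the finite multiplicity give the Fredholm property. At
  \<alpha>, infinitely many entries lie within every \<open>e > 0\<close>, which destroys
  it.\<close>

lemma ess_spectrum_abs_op: "ess_spectrum (abs_op T) = {complex_of_real \<alpha>}"
proof -
  have b: "bounded ((\<lambda>g. modulus g - z) ` G)" for z
    using bounded_translation_minus[OF bounded_modulus, of z] by (simp add: image_image)
  have "fredholm (minus_scalar (abs_op T) z)" if z: "z \<noteq> complex_of_real \<alpha>" for z
  proof -
    obtain \<delta> where "0 < \<delta>" "\<And>g. g \<in> G \<Longrightarrow> modulus g - z \<noteq> 0 \<Longrightarrow> \<delta> \<le> cmod (modulus g - z)"
      using gap[OF z] by blast
    then show ?thesis
      unfolding abs_op_eq_diag minus_scalar_diag[OF bounded_modulus]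
      using finite_level[OF z] by (intro fredholm_diag[OF b]) auto
  qed
  moreover have "\<not> fredholm (minus_scalar (abs_op T) (complex_of_real \<alpha>))"
    unfolding abs_op_eq_diag minus_scalar_diag[OF bounded_modulus]
  proof (rule not_fredholm_diag[OF b])
    fix e :: real assume "0 < e"
    have "infinite (G - {g \<in> G. e \<le> cmod (modulus g - complex_of_real \<alpha>)})"
      using inf_G finite_away[OF \<open>0 < e\<close>] by simp
    moreover have "G - {g \<in> G. e \<le> cmod (modulus g - complex_of_real \<alpha>)}
        = {g \<in> G. cmod (modulus g - complex_of_real \<alpha>) < e}" by auto
    ultimately show "infinite {g \<in> G. cmod (modulus g - complex_of_real \<alpha>) < e}" by simp
  qed
  ultimately show ?thesis by (auto simp: ess_spectrum_def)
qed

text \<open>The space may be non-separable, so countability cannot come from the basis as a whole;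
  it comes from the finitely many entries up to each
  \<open>\<alpha> - inverse (real (Suc k))\<close>.\<close>

lemma countable_levels_below: "countable ((\<lambda>g. norm (T g)) ` {g \<in> G. norm (T g) < \<alpha>})"
proof -
  have "{g \<in> G. norm (T g) < \<alpha>} \<subseteq> (\<Union>k::nat. {g \<in> G. norm (T g) \<le> \<alpha> - inverse (real (Suc k))})"
  proof
    fix g assume g: "g \<in> {g \<in> G. norm (T g) < \<alpha>}"
    then obtain k where "inverse (real (Suc k)) < \<alpha> - norm (T g)"
      using reals_Archimedean[of "\<alpha> - norm (T g)"] by auto
    then show "g \<in> (\<Union>k::nat. {g \<in> G. norm (T g) \<le> \<alpha> - inverse (real (Suc k))})"
      using g by (auto intro!: exI[of _ k])
  qed
  moreover have "countable (\<Union>k::nat. {g \<in> G. norm (T g) \<le> \<alpha> - inverse (real (Suc k))})"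
  proof (rule countable_UN)
    show "countable {g \<in> G. norm (T g) \<le> \<alpha> - inverse (real (Suc k))}" for k
      by (rule countable_finite[OF fin_below]) simp
  qed simp
  ultimately have "countable {g \<in> G. norm (T g) < \<alpha>}" by (rule countable_subset)
  then show ?thesis by (rule countable_image)
qed

end

section \<open>The structure theorem\<close>

lemma is_orth_sum_cong:
  assumes "\<And>i. i \<in> I \<Longrightarrow> M i = M' i"
  shows "is_orth_sum K I M \<longleftrightarrow> is_orth_sum K I M'"
  using assms by (simp add: is_orth_sum_def)

theorem theorem3p4:
  fixes T :: "'a::chilbert_space \<Rightarrow> 'a"
  assumes inf_dim: "\<not> cfinite_dim (UNIV :: 'a set)"
    and AM: "abs_min_attaining T"
    and qn: "quasinormal T"
  defines "N \<equiv> \<lambda>c::real. null_space (minus_scalar (abs_op T) (complex_of_real c))"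
  shows "\<exists>(H1 :: 'a set) (Hinf :: 'a set) (H2 :: 'a set) (n :: nat) (m :: enat) (J :: nat set)
      (\<alpha>s :: nat \<Rightarrow> real) (\<alpha> :: real) (\<beta>s :: nat \<Rightarrow> real)
      (U :: nat \<Rightarrow> 'a \<Rightarrow> 'a) (Vinf :: 'a \<Rightarrow> 'a) (V :: nat \<Rightarrow> 'a \<Rightarrow> 'a).
    J = {j. 1 \<le> j \<and> enat j \<le> m}
    \<and> inj_on \<alpha>s {1..n} \<and> inj_on \<beta>s J
    \<and> reducing T H1 \<and> reducing T Hinf \<and> reducing T H2
    \<and> cfinite_dim H1
    \<and> is_orth_sum UNIV {0, 1, 2} ((!) [H1, Hinf, H2])
    \<and> is_op_sum UNIV ({1..n} <+> {()} <+> J)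
        (case_sum (\<lambda>i. N (\<alpha>s i)) (case_sum (\<lambda>_. Hinf) (\<lambda>j. N (\<beta>s j))))
        (case_sum (\<lambda>i x. \<alpha>s i *\<^sub>R U i x)
          (case_sum (\<lambda>_ x. \<alpha> *\<^sub>R Vinf x) (\<lambda>j x. \<beta>s j *\<^sub>R V j x)))
        T
    \<and> (ess_spectrum (abs_op T) = {complex_of_real \<alpha>} \<and> \<alpha> \<ge> 0
        \<and> Hinf = N \<alpha> \<and> isometry_on Hinf Vinf)
    \<and> (complex_of_real ` \<alpha>s ` {1..n}
          = complex_of_real ` {\<alpha><..onorm T} \<inter> spectrum (abs_op T)
        \<and> is_orth_sum H1 {1..n} (\<lambda>i. N (\<alpha>s i))
        \<and> (\<forall>i\<in>{1..n}. unitary_on (N (\<alpha>s i)) (U i)))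
    \<and> (complex_of_real ` \<beta>s ` J
          = complex_of_real ` {min_modulus UNIV T..<\<alpha>} \<inter> spectrum (abs_op T)
        \<and> is_orth_sum H2 J (\<lambda>j. N (\<beta>s j))
        \<and> (\<forall>j\<in>J. unitary_on (N (\<beta>s j)) (V j)))"
proof -
  obtain G where "eigen_onb G T" using ex_eigen_onb[OF AM] by blast
  then interpret eigen_onb G T .
  interpret am_onb G T by unfold_locales (rule AM)
  interpret quasinormal_onb G T by unfold_locales (rule qn)
  have "infinite G"
    using inf_dim cfinite_dim_supported[of UNIV] by (auto simp: supported_UNIV)
  then obtain \<alpha> where \<alpha>: "0 \<le> \<alpha>" "finite {g \<in> G. \<alpha> < norm (T g)}"
    "\<And>b. b < \<alpha> \<Longrightarrow> finite {g \<in> G. norm (T g) \<le> b}"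
    using ex_essential_value by blast
  interpret essential_value G T \<alpha>
    by unfold_locales (use \<open>infinite G\<close> \<alpha> in auto)
  define A where "A = (\<lambda>g. norm (T g)) ` {g \<in> G. \<alpha> < norm (T g)}"
  define B where "B = (\<lambda>g. norm (T g)) ` {g \<in> G. norm (T g) < \<alpha>}"
  define n where "n = card A"
  have "finite A" using \<alpha>(2) by (simp add: A_def)
  then obtain \<alpha>s where \<alpha>s: "bij_betw \<alpha>s {1..n} A"
    using ex_bij_betw_nat_finite_1 unfolding n_def by blast
  have "countable B" unfolding B_def by (rule countable_levels_below)
  then obtain m \<beta>s where "bij_betw \<beta>s {j. 1 \<le> j \<and> enat j \<le> m} B"
    using countable_enumeration by blast
  define J where "J = {j. 1 \<le> j \<and> enat j \<le> m}"
  have \<beta>s: "bij_betw \<beta>s J B"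
    unfolding J_def by fact
  note inj = bij_betw_imp_inj_on[OF \<alpha>s] bij_betw_imp_inj_on[OF \<beta>s]
  note img = bij_betw_imp_surj_on[OF \<alpha>s] bij_betw_imp_surj_on[OF \<beta>s]
  have \<alpha>s_gt: "\<alpha> < \<alpha>s i" if "i \<in> {1..n}" for i
  proof -
    have "\<alpha>s i \<in> A" using img(1) that by blast
    then show ?thesis by (auto simp: A_def)
  qed
  have \<beta>s_lt: "0 \<le> \<beta>s j" "\<beta>s j < \<alpha>" if "j \<in> J" for j
  proof -
    have "\<beta>s j \<in> B" using img(2) that by blast
    then show "0 \<le> \<beta>s j" "\<beta>s j < \<alpha>" by (auto simp: B_def)
  qed
  have mem_A: "norm (T g) \<in> A \<longleftrightarrow> \<alpha> < norm (T g)"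
    and mem_B: "norm (T g) \<in> B \<longleftrightarrow> norm (T g) < \<alpha>" if "g \<in> G" for g
    using that by (auto simp: A_def B_def)
  have N: "N c = levels {c}" for c
    unfolding N_def by (rule null_space_abs_op)
  have fin_level: "finite {g \<in> G. norm (T g) = c}" if "c \<noteq> \<alpha>" for c
    using finite_level[of "complex_of_real c"] that by simp
  define H1 where "H1 = levels {\<alpha><..}"
  define H2 where "H2 = levels {..<\<alpha>}"
  have "is_orth_sum UNIV {0, 1, 2} ((!) [H1, N \<alpha>, H2])"
  proof -
    have "is_orth_sum (levels UNIV) {0, 1, 2::nat} (\<lambda>i. levels ([{\<alpha><..}, {\<alpha>}, {..<\<alpha>}] ! i))"
      by (rule is_orth_sum_levels) auto
    moreover have "levels UNIV = UNIV" by (simp add: levels_def supported_UNIV)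
    moreover have "levels ([{\<alpha><..}, {\<alpha>}, {..<\<alpha>}] ! i) = [H1, N \<alpha>, H2] ! i" if "i \<in> {0, 1, 2}" for i
      using that by (auto simp: H1_def H2_def N)
    ultimately show ?thesis
      using is_orth_sum_cong[of "{0, 1, 2}" "\<lambda>i. levels ([{\<alpha><..}, {\<alpha>}, {..<\<alpha>}] ! i)"] by metis
  qed
  moreover have "is_op_sum UNIV ({1..n} <+> {()} <+> J)
        (case_sum (\<lambda>i. N (\<alpha>s i)) (case_sum (\<lambda>_. N \<alpha>) (\<lambda>j. N (\<beta>s j))))
        (case_sum (\<lambda>i x. \<alpha>s i *\<^sub>R phase (\<alpha>s i) x)
          (case_sum (\<lambda>_ x. \<alpha> *\<^sub>R phase \<alpha> x) (\<lambda>j x. \<beta>s j *\<^sub>R phase (\<beta>s j) x))) T"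
  proof -
    \<comment> \<open>All three families are gathered over one sum type. Injectivity across the
      families holds since their values lie above, at and below \<alpha>.\<close>
    define c where "c = case_sum \<alpha>s (case_sum (\<lambda>_::unit. \<alpha>) \<beta>s)"
    have "inj_on c ({1..n} <+> {()} <+> J)"
    proof (rule inj_onI)
      have cases: "(\<exists>a\<in>{1..n}. i = Inl a \<and> \<alpha> < c i \<and> c i = \<alpha>s a) \<or> (i = Inr (Inl ()) \<and> c i = \<alpha>)
          \<or> (\<exists>b\<in>J. i = Inr (Inr b) \<and> c i < \<alpha> \<and> c i = \<beta>s b)" if "i \<in> {1..n} <+> {()} <+> J" for i
        using that by (elim PlusE) (auto simp: c_def \<alpha>s_gt \<beta>s_lt)
      fix i j assume "i \<in> {1..n} <+> {()} <+> J" "j \<in> {1..n} <+> {()} <+> J" and eq: "c i = c j"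
      from cases[OF this(1)] cases[OF this(2)] eq show "i = j"
        by (elim disjE bexE conjE) (simp_all add: inj_on_eq_iff[OF inj(1)] inj_on_eq_iff[OF inj(2)])
    qed
    moreover have "norm (T g) \<in> c ` ({1..n} <+> {()} <+> J)" if "g \<in> G" for g
    proof -
      have "c ` ({1..n} <+> {()} <+> J) = A \<union> {\<alpha>} \<union> B"
        by (simp add: Plus_def image_Un image_image c_def img del: One_nat_def)
      moreover have "norm (T g) \<in> A \<union> {\<alpha>} \<union> B"
        by (cases "norm (T g)" \<alpha> rule: linorder_cases) (simp_all add: mem_A[OF that] mem_B[OF that])
      ultimately show ?thesis by simp
    qed
    moreover have "0 \<le> c i" if "i \<in> {1..n} <+> {()} <+> J" for i
    proof -
      have "0 \<le> \<alpha>s a" if "a \<in> {1..n}" for a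
        using \<alpha>s_gt[OF that] \<alpha>(1) by linarith
      then show ?thesis
        using that \<alpha>(1) \<beta>s_lt(1) by (elim PlusE) (simp_all add: c_def)
    qed
    ultimately have "is_op_sum UNIV ({1..n} <+> {()} <+> J) (\<lambda>i. levels {c i})
        (\<lambda>i x. c i *\<^sub>R phase (c i) x) T"
      by (rule is_op_sum_levels)
    moreover have "(\<lambda>i. levels {c i})
        = case_sum (\<lambda>i. N (\<alpha>s i)) (case_sum (\<lambda>_. N \<alpha>) (\<lambda>j. N (\<beta>s j)))"
      by (auto simp: fun_eq_iff c_def N split: sum.split)
    moreover have "(\<lambda>i x. c i *\<^sub>R phase (c i) x)
        = case_sum (\<lambda>i x. \<alpha>s i *\<^sub>R phase (\<alpha>s i) x)
          (case_sum (\<lambda>_ x. \<alpha> *\<^sub>R phase \<alpha> x) (\<lambda>j x. \<beta>s j *\<^sub>R phase (\<beta>s j) x))"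
      by (auto simp: fun_eq_iff c_def split: sum.split)
    ultimately show ?thesis by simp
  qed
  moreover have "cfinite_dim H1"
    unfolding H1_def levels_def
    by (rule cfinite_dim_supported) (use \<alpha>(2) in \<open>simp add: Int_def\<close>)
  moreover have "complex_of_real ` \<alpha>s ` {1..n} = complex_of_real ` {\<alpha><..onorm T} \<inter> spectrum (abs_op T)"
  proof -
    \<comment> \<open>The case \<open>c = \<alpha>\<close> is separated because
      \<open>spectrum_abs_op\<close> does not cover it; there both sides are false.\<close>
    have "c \<in> A \<longleftrightarrow> c \<in> {\<alpha><..onorm T} \<and> complex_of_real c \<in> spectrum (abs_op T)" for c
      using norm_T_basis_le spectrum_abs_op[of "complex_of_real c"]
      by (cases "c = \<alpha>") (auto simp: A_def image_iff)
    then show ?thesis unfolding img by auto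
  qed
  moreover have "complex_of_real ` \<beta>s ` J
      = complex_of_real ` {min_modulus UNIV T..<\<alpha>} \<inter> spectrum (abs_op T)"
  proof -
    have "c \<in> B \<longleftrightarrow> c \<in> {min_modulus UNIV T..<\<alpha>} \<and> complex_of_real c \<in> spectrum (abs_op T)" for c
      using min_modulus_le[OF UNIV_I norm_basis] spectrum_abs_op[of "complex_of_real c"]
      by (cases "c = \<alpha>") (auto simp: B_def image_iff)
    then show ?thesis unfolding img by auto
  qed
  moreover have "is_orth_sum H1 {1..n} (\<lambda>i. N (\<alpha>s i))"
    unfolding H1_def N
  proof (rule is_orth_sum_levels)
    show "norm (T g) \<in> {\<alpha><..} \<longleftrightarrow> norm (T g) \<in> (\<Union>i\<in>{1..n}. {\<alpha>s i})" if "g \<in> G" for g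
      using mem_A[OF that] unfolding img(1)[symmetric] by auto
    show "{\<alpha>s i} \<inter> {\<alpha>s j} = {}" if "i \<in> {1..n}" "j \<in> {1..n}" "i \<noteq> j" for i j
      using inj_onD[OF inj(1)] that by blast
  qed
  moreover have "is_orth_sum H2 J (\<lambda>j. N (\<beta>s j))"
    unfolding H2_def N
  proof (rule is_orth_sum_levels)
    show "norm (T g) \<in> {..<\<alpha>} \<longleftrightarrow> norm (T g) \<in> (\<Union>i\<in>J. {\<beta>s i})" if "g \<in> G" for g
      using mem_B[OF that] unfolding img(2)[symmetric] by auto
    show "{\<beta>s i} \<inter> {\<beta>s j} = {}" if "i \<in> J" "j \<in> J" "i \<noteq> j" for i j
      using inj_onD[OF inj(2)] that by blast
  qed
  moreover have "\<forall>i\<in>{1..n}. unitary_on (N (\<alpha>s i)) (phase (\<alpha>s i))"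
    unfolding N using \<alpha>s_gt by (intro ballI unitary_on_phase fin_level) auto
  moreover have "\<forall>j\<in>J. unitary_on (N (\<beta>s j)) (phase (\<beta>s j))"
    unfolding N using \<beta>s_lt by (intro ballI unitary_on_phase fin_level) auto
  moreover have "isometry_on (N \<alpha>) (phase \<alpha>)"
    unfolding N using \<alpha>(1) by (rule isometry_on_phase)
  moreover have "reducing T H1" "reducing T (N \<alpha>)" "reducing T H2"
    unfolding H1_def H2_def N by (rule reducing_levels)+
  ultimately show ?thesis
    using inj ess_spectrum_abs_op \<alpha>(1) J_def
    by - (rule exI[of _ H1], rule exI[of _ "N \<alpha>"], rule exI[of _ H2], rule exI[of _ n],
        rule exI[of _ m], rule exI[of _ J], rule exI[of _ \<alpha>s], rule exI[of _ \<alpha>],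
        rule exI[of _ \<beta>s], rule exI[of _ "\<lambda>i. phase (\<alpha>s i)"], rule exI[of _ "phase \<alpha>"],
        rule exI[of _ "\<lambda>j. phase (\<beta>s j)"], intro conjI, (assumption | rule refl)+)
qed

end
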